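(* Let $\Lambda$ be a finite-dimensional basic algebra over a field $k$ with Jacobson radical $J$ satisfying $J^n=0$, let $e_i,e_j$ be primitive idempotents with $V_{ij}=e_jJ^{n-1}e_i\neq 0$, let $\ell_{ij}=\dim_{D_j}V_{ij}$ and $1\le s\le\ell_{ij}$. For every $U\in\operatorname{Gr}_{D_j}(\ell_{ij}-s,V_{ij})$, the subspace $K_U=W_j\oplus U$ is a left $\Lambda$-submodule of $P_i=\Lambda e_i$. Moreover, for every $1\le d<n$, the module $M_U=P_i/K_U$ satisfies $M_U/J^dM_U\cong P_i/J^dP_i$. Thus all modules $M_U$ have the same complete tower of proper radical truncations.
   Context: Modules are finite-dimensional left $\Lambda$-modules, $n\ge 1$, and $J^0=\Lambda$. Fix a complete set $e_1,\dots,e_t$ of primitive orthogonal idempotents of $\Lambda$, with $e_i,e_j$ among them; $\Lambda$ basic means the modules $\Lambda e_h$ are pairwise non-isomorphic. $D_h=e_h\Lambda e_h/e_hJe_h$ is a division algebra, and $V_{ij}=e_jJ^{n-1}e_i$ is a $(D_j,D_i)$-bimodule via left and right multiplication. $\operatorname{Gr}_{D_j}(\ell_{ij}-s,V_{ij})$ is the set of left $D_j$-submodules $U\subseteq V_{ij}$ with $\dim_{D_j}(V_{ij}/U)=s$. $W_j=\bigoplus_{h\neq j}e_hJ^{n-1}P_i$. The proper radical truncations of a module $M$ are the quotients $M/J^dM$ with $1\le d<n$. *)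

theory Defs
  imports "HOL-Algebra.Module" "HOL-Algebra.QuotRing" "HOL-Algebra.Ideal_Product"
begin

section \<open>Left modules over a not necessarily commutative ring\<close>

text \<open>
  The locale \<^locale>\<open>module\<close> requires a commutative ring of scalars.  We keep its record type
  for left modules over arbitrary rings; the fields \<open>mult\<close> and \<open>one\<close> of such a record carry
  no information.  The locale \<^locale>\<open>submodule\<close> makes no commutativity assumption and is used
  as it stands.
\<close>

locale left_module = R?: ring R + M?: abelian_group M
  for R :: "('r, 'k) ring_scheme" (structure) and M :: "('r, 'b, 'm) module_scheme" (structure) +
  assumes smult_closed:
      "\<lbrakk>a \<in> carrier R; x \<in> carrier M\<rbrakk> \<Longrightarrow> a \<odot>\<^bsub>M\<^esub> x \<in> carrier M"
    and smult_l_distr: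
      "\<lbrakk>a \<in> carrier R; b \<in> carrier R; x \<in> carrier M\<rbrakk> \<Longrightarrow>
        (a \<oplus>\<^bsub>R\<^esub> b) \<odot>\<^bsub>M\<^esub> x = a \<odot>\<^bsub>M\<^esub> x \<oplus>\<^bsub>M\<^esub> b \<odot>\<^bsub>M\<^esub> x"
    and smult_r_distr:
      "\<lbrakk>a \<in> carrier R; x \<in> carrier M; y \<in> carrier M\<rbrakk> \<Longrightarrow>
        a \<odot>\<^bsub>M\<^esub> (x \<oplus>\<^bsub>M\<^esub> y) = a \<odot>\<^bsub>M\<^esub> x \<oplus>\<^bsub>M\<^esub> a \<odot>\<^bsub>M\<^esub> y"
    and smult_assoc1:
      "\<lbrakk>a \<in> carrier R; b \<in> carrier R; x \<in> carrier M\<rbrakk> \<Longrightarrow>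
        (a \<otimes>\<^bsub>R\<^esub> b) \<odot>\<^bsub>M\<^esub> x = a \<odot>\<^bsub>M\<^esub> (b \<odot>\<^bsub>M\<^esub> x)"
    and smult_one:
      "x \<in> carrier M \<Longrightarrow> \<one>\<^bsub>R\<^esub> \<odot>\<^bsub>M\<^esub> x = x"

definition regular_module :: "('a, 'm) ring_scheme \<Rightarrow> ('a, 'a) module" where
  "regular_module R = \<lparr>carrier = carrier R, mult = mult R, one = one R, zero = zero R,
     add = add R, smult = mult R\<rparr>"

definition principal_module :: "('a, 'm) ring_scheme \<Rightarrow> 'a \<Rightarrow> ('a, 'a) module" where
  "principal_module R e = (regular_module R)\<lparr>carrier := (\<lambda>x. x \<otimes>\<^bsub>R\<^esub> e) ` carrier R\<rparr>"

definition quotient_module ::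
    "('r, 'b, 'm) module_scheme \<Rightarrow> 'b set \<Rightarrow> ('r, 'b set) module" where
  "quotient_module M N = \<lparr>carrier = a_rcosets\<^bsub>M\<^esub> N, mult = undefined, one = undefined,
     zero = N, add = set_add M,
     smult = (\<lambda>r X. \<Union>x\<in>X. N +>\<^bsub>M\<^esub> (r \<odot>\<^bsub>M\<^esub> x))\<rparr>"

lemma (in ring) left_module_regular: "left_module R (regular_module R)"
proof -
  have "abelian_group (regular_module R)"
    by (rule abelian_groupI)
      (auto simp: regular_module_def a_ac intro!: bexI[of _ "\<ominus> x" for x] l_neg)
  then show ?thesis
    by (intro left_module.intro left_module_axioms.intro)
      (auto simp: regular_module_def ring_axioms l_distr r_distr m_assoc)
qed

context left_module
begin

lemma submodule_left_module:
  assumes "submodule H R M"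
  shows "left_module R (M\<lparr>carrier := H\<rparr>)"
proof -
  interpret H: submodule H R M by fact
  have sub: "H \<subseteq> carrier M" using H.subset by simp
  have "comm_group ((add_monoid M)\<lparr>carrier := H\<rparr>)"
    by (intro group.group_comm_groupI H.subgroup_is_group M.a_group)
      (use sub in \<open>auto simp: M.a_comm subset_iff\<close>)
  then have "abelian_group (M\<lparr>carrier := H\<rparr>)"
    by (intro abelian_group.intro abelian_monoid.intro abelian_group_axioms.intro)
       (simp_all add: comm_group_def)
  then show ?thesis
    using sub by (intro left_module.intro left_module_axioms.intro)
      (auto simp: R.ring_axioms smult_l_distr smult_r_distr smult_assoc1 smult_one subset_iff)
qed

lemma quotient_left_module:
  assumes "submodule N R M"
  shows "left_module R (quotient_module M N)"
proof -
  interpret N: submodule N R M by fact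
  have sN: "subgroup N (add_monoid M)" by (rule N.subgroup_axioms)
  interpret N': abelian_subgroup N M
    using sN by (intro abelian_subgroupI3 additive_subgroupI M.abelian_group_axioms)
  have sub: "N \<subseteq> carrier M" using N'.a_subset .
  have self: "x \<in> N +>\<^bsub>M\<^esub> x" if "x \<in> carrier M" for x
    using N'.a_rcos_self that by blast
  have eqc: "N +>\<^bsub>M\<^esub> (r \<odot>\<^bsub>M\<^esub> y) = N +>\<^bsub>M\<^esub> (r \<odot>\<^bsub>M\<^esub> x)"
    if r: "r \<in> carrier R" and x: "x \<in> carrier M" and y: "y \<in> N +>\<^bsub>M\<^esub> x" for r x y
  proof -
    obtain h where h: "h \<in> N" "y = h \<oplus>\<^bsub>M\<^esub> x" using y by (auto simp: a_r_coset_def')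
    have "r \<odot>\<^bsub>M\<^esub> y = r \<odot>\<^bsub>M\<^esub> h \<oplus>\<^bsub>M\<^esub> r \<odot>\<^bsub>M\<^esub> x"
      using h r x sub by (simp add: smult_r_distr subset_iff)
    moreover have "r \<odot>\<^bsub>M\<^esub> h \<in> N" using h r by (simp add: N.smult_closed)
    ultimately have "r \<odot>\<^bsub>M\<^esub> y \<in> N +>\<^bsub>M\<^esub> (r \<odot>\<^bsub>M\<^esub> x)" by (auto simp: a_r_coset_def')
    then show ?thesis
      using M.a_repr_independence[OF _ _ sN, of "r \<odot>\<^bsub>M\<^esub> y" "r \<odot>\<^bsub>M\<^esub> x"] smult_closed r x by simp
  qed
  have sm: "r \<odot>\<^bsub>quotient_module M N\<^esub> (N +>\<^bsub>M\<^esub> x) = N +>\<^bsub>M\<^esub> (r \<odot>\<^bsub>M\<^esub> x)"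
    if "r \<in> carrier R" "x \<in> carrier M" for r x
  proof -
    have "(\<Union>y\<in>N +>\<^bsub>M\<^esub> x. N +>\<^bsub>M\<^esub> (r \<odot>\<^bsub>M\<^esub> y)) = N +>\<^bsub>M\<^esub> (r \<odot>\<^bsub>M\<^esub> x)"
      using eqc[OF that] self[OF that(2)] by blast
    then show ?thesis by (simp add: quotient_module_def)
  qed
  have car: "carrier (quotient_module M N) = (\<lambda>x. N +>\<^bsub>M\<^esub> x) ` carrier M"
    by (auto simp: quotient_module_def A_RCOSETS_def')
  have add: "(N +>\<^bsub>M\<^esub> x) \<oplus>\<^bsub>quotient_module M N\<^esub> (N +>\<^bsub>M\<^esub> y) = N +>\<^bsub>M\<^esub> (x \<oplus>\<^bsub>M\<^esub> y)"
    if "x \<in> carrier M" "y \<in> carrier M" for x y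
    using N'.a_rcos_sum that by (simp add: quotient_module_def)
  have zero: "\<zero>\<^bsub>quotient_module M N\<^esub> = N +>\<^bsub>M\<^esub> \<zero>\<^bsub>M\<^esub>"
    using sub by (simp add: quotient_module_def M.a_coset_add_zero)
  have "abelian_group (quotient_module M N)"
  proof (rule abelian_groupI)
    fix X assume "X \<in> carrier (quotient_module M N)"
    then obtain x where x: "x \<in> carrier M" "X = N +>\<^bsub>M\<^esub> x" by (auto simp: car)
    then show "\<exists>Y\<in>carrier (quotient_module M N).
        Y \<oplus>\<^bsub>quotient_module M N\<^esub> X = \<zero>\<^bsub>quotient_module M N\<^esub>"
      by (intro bexI[of _ "N +>\<^bsub>M\<^esub> (\<ominus>\<^bsub>M\<^esub> x)"]) (auto simp: car add zero M.l_neg)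
  qed (auto simp: car add zero M.a_ac)
  then show ?thesis
    by (intro left_module.intro left_module_axioms.intro)
      (auto simp: R.ring_axioms car sm add smult_closed smult_l_distr smult_r_distr
         smult_assoc1 smult_one)
qed

end

lemma (in ring) principal_left_module:
  assumes e: "e \<in> carrier R"
  shows "left_module R (principal_module R e)"
proof -
  interpret L: left_module R "regular_module R" by (rule left_module_regular)
  have "submodule ((\<lambda>x. x \<otimes> e) ` carrier R) R (regular_module R)"
  proof (intro submodule.intro submodule_axioms.intro)
    show "subgroup ((\<lambda>x. x \<otimes> e) ` carrier R) (add_monoid (regular_module R))"
    proof (rule group.subgroupI[OF abelian_group.a_group[OF L.M.abelian_group_axioms]])
      fix a b assume "a \<in> (\<lambda>x. x \<otimes> e) ` carrier R" "b \<in> (\<lambda>x. x \<otimes> e) ` carrier R"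
      then obtain x y where "x \<in> carrier R" "y \<in> carrier R" "a = x \<otimes> e" "b = y \<otimes> e" by auto
      with e show "a \<otimes>\<^bsub>add_monoid (regular_module R)\<^esub> b \<in> (\<lambda>x. x \<otimes> e) ` carrier R"
        by (intro image_eqI[of _ _ "x \<oplus> y"]) (auto simp: regular_module_def l_distr)
    next
      fix a assume "a \<in> (\<lambda>x. x \<otimes> e) ` carrier R"
      then obtain x where x: "x \<in> carrier R" "a = x \<otimes> e" by auto
      have "inv\<^bsub>add_monoid (regular_module R)\<^esub> a = \<ominus> a"
        by (simp add: regular_module_def a_inv_def m_inv_def)
      with x e show "inv\<^bsub>add_monoid (regular_module R)\<^esub> a \<in> (\<lambda>x. x \<otimes> e) ` carrier R"
        by (intro image_eqI[of _ _ "\<ominus> x"]) (auto simp: l_minus)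
    qed (use e in \<open>auto simp: regular_module_def\<close>)
  next
    fix a x assume "a \<in> carrier R" "x \<in> (\<lambda>x. x \<otimes> e) ` carrier R"
    then show "a \<odot>\<^bsub>regular_module R\<^esub> x \<in> (\<lambda>x. x \<otimes> e) ` carrier R"
      using e by (auto simp: regular_module_def m_assoc[symmetric])
  qed
  then show ?thesis
    unfolding principal_module_def by (rule L.submodule_left_module)
qed

definition left_module_iso_maps ::
    "('r, 'k) ring_scheme \<Rightarrow> ('r, 'b, 'm) module_scheme \<Rightarrow> ('r, 'c, 'n) module_scheme
      \<Rightarrow> ('b \<Rightarrow> 'c) set" where
  "left_module_iso_maps R M N = {f. bij_betw f (carrier M) (carrier N) \<and>
     (\<forall>x\<in>carrier M. \<forall>y\<in>carrier M. f (x \<oplus>\<^bsub>M\<^esub> y) = f x \<oplus>\<^bsub>N\<^esub> f y) \<and>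
     (\<forall>r\<in>carrier R. \<forall>x\<in>carrier M. f (r \<odot>\<^bsub>M\<^esub> x) = r \<odot>\<^bsub>N\<^esub> f x)}"

definition left_module_isomorphic ::
    "('r, 'k) ring_scheme \<Rightarrow> ('r, 'b, 'm) module_scheme \<Rightarrow> ('r, 'c, 'n) module_scheme
      \<Rightarrow> bool" where
  "left_module_isomorphic R M N \<longleftrightarrow> left_module_iso_maps R M N \<noteq> {}"

definition module_span ::
    "('r, 'k) ring_scheme \<Rightarrow> ('r, 'b, 'm) module_scheme \<Rightarrow> 'b set \<Rightarrow> 'b set" where
  "module_span R M B = \<Inter> {N. submodule N R M \<and> B \<subseteq> N}"

definition module_independent ::
    "('r, 'k) ring_scheme \<Rightarrow> ('r, 'b, 'm) module_scheme \<Rightarrow> 'b set \<Rightarrow> bool" where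
  "module_independent R M B \<longleftrightarrow>
     (\<forall>F c. finite F \<and> F \<subseteq> B \<and> c \<in> F \<rightarrow> carrier R \<and>
        finsum M (\<lambda>v. c v \<odot>\<^bsub>M\<^esub> v) F = \<zero>\<^bsub>M\<^esub> \<longrightarrow> (\<forall>v\<in>F. c v = \<zero>\<^bsub>R\<^esub>))"

definition module_basis ::
    "('r, 'k) ring_scheme \<Rightarrow> ('r, 'b, 'm) module_scheme \<Rightarrow> 'b set \<Rightarrow> bool" where
  "module_basis R M B \<longleftrightarrow>
     B \<subseteq> carrier M \<and> module_independent R M B \<and> module_span R M B = carrier M"

text \<open>
  Intended for left modules over a division ring: every such module has a basis, and all its
  bases have the same cardinality.
\<close>

definition module_dim :: "('r, 'k) ring_scheme \<Rightarrow> ('r, 'b, 'm) module_scheme \<Rightarrow> nat" where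
  "module_dim R M = card (SOME B. module_basis R M B)"

text \<open>The submodules of dimension \<open>dim V - s\<close>, described by their codimension \<open>s\<close>.\<close>

definition grassmannian_codim ::
    "('r, 'k) ring_scheme \<Rightarrow> ('r, 'b, 'm) module_scheme \<Rightarrow> nat \<Rightarrow> 'b set set" where
  "grassmannian_codim D V s =
     {U. submodule U D V \<and> module_dim D (quotient_module V U) = s}"


section \<open>Jacobson radical and radical truncations\<close>

definition maximal_left_ideal :: "'a set \<Rightarrow> ('a, 'm) ring_scheme \<Rightarrow> bool" where
  "maximal_left_ideal I R \<longleftrightarrow>
     submodule I R (regular_module R) \<and> I \<noteq> carrier R \<and>
     (\<forall>I'. submodule I' R (regular_module R) \<and> I \<subseteq> I' \<longrightarrow> I' = I \<or> I' = carrier R)"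

definition jacobson_radical :: "('a, 'm) ring_scheme \<Rightarrow> 'a set" where
  "jacobson_radical R = carrier R \<inter> \<Inter> {I. maximal_left_ideal I R}"

primrec ideal_power :: "('a, 'm) ring_scheme \<Rightarrow> 'a set \<Rightarrow> nat \<Rightarrow> 'a set" where
  "ideal_power R I 0 = carrier R"
| "ideal_power R I (Suc m) = ideal_prod R I (ideal_power R I m)"

text \<open>The submodule \<open>I M\<close> of \<open>M\<close>.\<close>

inductive_set ideal_smult ::
    "('r, 'b, 'm) module_scheme \<Rightarrow> 'r set \<Rightarrow> 'b set"
  for M and I where
    zero: "\<zero>\<^bsub>M\<^esub> \<in> ideal_smult M I"
  | smult: "\<lbrakk>a \<in> I; x \<in> carrier M\<rbrakk> \<Longrightarrow> a \<odot>\<^bsub>M\<^esub> x \<in> ideal_smult M I"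
  | sum: "\<lbrakk>x \<in> ideal_smult M I; y \<in> ideal_smult M I\<rbrakk> \<Longrightarrow> x \<oplus>\<^bsub>M\<^esub> y \<in> ideal_smult M I"

definition radical_submodule ::
    "('r, 'k) ring_scheme \<Rightarrow> ('r, 'b, 'm) module_scheme \<Rightarrow> nat \<Rightarrow> 'b set" where
  "radical_submodule R M d = ideal_smult M (ideal_power R (jacobson_radical R) d)"

definition radical_truncation ::
    "('r, 'k) ring_scheme \<Rightarrow> ('r, 'b, 'm) module_scheme \<Rightarrow> nat \<Rightarrow> ('r, 'b set) module" where
  "radical_truncation R M d = quotient_module M (radical_submodule R M d)"

text \<open>
  The canonical projection from \<open>M / J\<^sup>d\<^sup>+\<^sup>1 M\<close> to \<open>M / J\<^sup>d M\<close>: it enlarges a coset of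
  \<open>J\<^sup>d\<^sup>+\<^sup>1 M\<close> to the coset of \<open>J\<^sup>d M\<close> containing it.
\<close>

definition truncation_proj ::
    "('r, 'k) ring_scheme \<Rightarrow> ('r, 'b, 'm) module_scheme \<Rightarrow> nat \<Rightarrow> 'b set \<Rightarrow> 'b set" where
  "truncation_proj R M d X = radical_submodule R M d <+>\<^bsub>M\<^esub> X"

text \<open>
  Isomorphism of the towers formed by \<open>M / J\<^sup>d M\<close> for \<open>1 \<le> d < n\<close> and the canonical
  projections between them.
\<close>

definition same_proper_truncation_tower ::
    "('r, 'k) ring_scheme \<Rightarrow> nat \<Rightarrow> ('r, 'b, 'm) module_scheme \<Rightarrow> ('r, 'c, 'l) module_scheme
      \<Rightarrow> bool" where
  "same_proper_truncation_tower R n M N \<longleftrightarrow>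
     (\<exists>\<phi>. (\<forall>d. 1 \<le> d \<and> d < n \<longrightarrow>
              \<phi> d \<in> left_module_iso_maps R (radical_truncation R M d) (radical_truncation R N d)) \<and>
          (\<forall>d. 1 \<le> d \<and> d + 1 < n \<longrightarrow>
              (\<forall>X \<in> carrier (radical_truncation R M (d + 1)).
                 \<phi> d (truncation_proj R M d X) = truncation_proj R N d (\<phi> (d + 1) X))))"


section \<open>Finite-dimensional basic algebras\<close>

locale fin_dim_algebra = K?: field K + module K A + A?: ring A
  for K :: "('k, 'kx) ring_scheme" (structure) and A :: "('k, 'a, 'ax) module_scheme" (structure) +
  assumes smult_mult_left:
      "\<lbrakk>a \<in> carrier K; x \<in> carrier A; y \<in> carrier A\<rbrakk> \<Longrightarrow>
        (a \<odot>\<^bsub>A\<^esub> x) \<otimes>\<^bsub>A\<^esub> y = a \<odot>\<^bsub>A\<^esub> (x \<otimes>\<^bsub>A\<^esub> y)"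
    and smult_mult_right:
      "\<lbrakk>a \<in> carrier K; x \<in> carrier A; y \<in> carrier A\<rbrakk> \<Longrightarrow>
        x \<otimes>\<^bsub>A\<^esub> (a \<odot>\<^bsub>A\<^esub> y) = a \<odot>\<^bsub>A\<^esub> (x \<otimes>\<^bsub>A\<^esub> y)"
    and fin_dim:
      "\<exists>B. finite B \<and> B \<subseteq> carrier A \<and> module_span K A B = carrier A"

definition idempotent_elem :: "('a, 'm) ring_scheme \<Rightarrow> 'a \<Rightarrow> bool" where
  "idempotent_elem R e \<longleftrightarrow> e \<in> carrier R \<and> e \<otimes>\<^bsub>R\<^esub> e = e"

definition primitive_idempotent :: "('a, 'm) ring_scheme \<Rightarrow> 'a \<Rightarrow> bool" where
  "primitive_idempotent R e \<longleftrightarrow> idempotent_elem R e \<and> e \<noteq> \<zero>\<^bsub>R\<^esub> \<and>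
     (\<forall>f g. idempotent_elem R f \<and> idempotent_elem R g \<and>
        f \<otimes>\<^bsub>R\<^esub> g = \<zero>\<^bsub>R\<^esub> \<and> g \<otimes>\<^bsub>R\<^esub> f = \<zero>\<^bsub>R\<^esub> \<and> e = f \<oplus>\<^bsub>R\<^esub> g
        \<longrightarrow> f = \<zero>\<^bsub>R\<^esub> \<or> g = \<zero>\<^bsub>R\<^esub>)"

definition complete_primitive_idempotents ::
    "('a, 'm) ring_scheme \<Rightarrow> nat \<Rightarrow> (nat \<Rightarrow> 'a) \<Rightarrow> bool" where
  "complete_primitive_idempotents R t e \<longleftrightarrow>
     (\<forall>h\<in>{1..t}. primitive_idempotent R (e h)) \<and>
     (\<forall>h\<in>{1..t}. \<forall>l\<in>{1..t}. h \<noteq> l \<longrightarrow> e h \<otimes>\<^bsub>R\<^esub> e l = \<zero>\<^bsub>R\<^esub>) \<and>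
     finsum R e {1..t} = \<one>\<^bsub>R\<^esub>"

definition basic_wrt :: "('a, 'm) ring_scheme \<Rightarrow> nat \<Rightarrow> (nat \<Rightarrow> 'a) \<Rightarrow> bool" where
  "basic_wrt R t e \<longleftrightarrow>
     (\<forall>h\<in>{1..t}. \<forall>l\<in>{1..t}. h \<noteq> l \<longrightarrow>
        \<not> left_module_isomorphic R (principal_module R (e h)) (principal_module R (e l)))"

text \<open>The set \<open>e X f\<close>.\<close>

definition corner :: "('a, 'm) ring_scheme \<Rightarrow> 'a \<Rightarrow> 'a set \<Rightarrow> 'a \<Rightarrow> 'a set" where
  "corner R e X f = (\<lambda>x. e \<otimes>\<^bsub>R\<^esub> x \<otimes>\<^bsub>R\<^esub> f) ` X"

definition corner_ring :: "('a, 'm) ring_scheme \<Rightarrow> 'a \<Rightarrow> 'a ring" where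
  "corner_ring R e = \<lparr>carrier = corner R e (carrier R) e, mult = mult R, one = e,
     zero = zero R, add = add R\<rparr>"

definition residue_division_ring :: "('a, 'm) ring_scheme \<Rightarrow> 'a \<Rightarrow> 'a set ring" where
  "residue_division_ring R e = corner_ring R e Quot corner R e (jacobson_radical R) e"

text \<open>
  \<open>e J\<^sup>n\<^sup>-\<^sup>1 f\<close> with the left action of \<open>e R e / e J e\<close> induced by multiplication.  If \<open>J\<^sup>n = 0\<close>,
  the product \<open>a v\<close> is the same for all representatives \<open>a\<close> of a residue class \<open>X\<close>, because
  \<open>J J\<^sup>n\<^sup>-\<^sup>1 = 0\<close>; the action of \<open>X\<close> on \<open>v\<close> is this common value.
\<close>

definition top_corner_module ::
    "('a, 'm) ring_scheme \<Rightarrow> nat \<Rightarrow> 'a \<Rightarrow> 'a \<Rightarrow> ('a set, 'a) module" where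
  "top_corner_module R n e f = \<lparr>
     carrier = corner R e (ideal_power R (jacobson_radical R) (n - 1)) f,
     mult = mult R, one = one R, zero = zero R, add = add R,
     smult = (\<lambda>X v. the_elem ((\<lambda>a. a \<otimes>\<^bsub>R\<^esub> v) ` X))\<rparr>"

definition sum_of_family :: "('a, 'm) ring_scheme \<Rightarrow> 'i set \<Rightarrow> ('i \<Rightarrow> 'a set) \<Rightarrow> 'a set" where
  "sum_of_family R I X = {finsum R x I | x. x \<in> Pi I X}"

definition sum_is_direct :: "('a, 'm) ring_scheme \<Rightarrow> 'i set \<Rightarrow> ('i \<Rightarrow> 'a set) \<Rightarrow> bool" where
  "sum_is_direct R I X \<longleftrightarrow>
     (\<forall>x \<in> Pi I X. finsum R x I = \<zero>\<^bsub>R\<^esub> \<longrightarrow> (\<forall>h\<in>I. x h = \<zero>\<^bsub>R\<^esub>))"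

text \<open>The subspace \<open>e\<^sub>h J\<^sup>n\<^sup>-\<^sup>1 P\<^sub>i\<close> of \<open>P\<^sub>i\<close>.\<close>

definition top_component ::
    "('a, 'm) ring_scheme \<Rightarrow> nat \<Rightarrow> (nat \<Rightarrow> 'a) \<Rightarrow> nat \<Rightarrow> nat \<Rightarrow> 'a set" where
  "top_component R n e i h =
     (\<lambda>x. e h \<otimes>\<^bsub>R\<^esub> x) ` radical_submodule R (principal_module R (e i)) (n - 1)"

definition W_sub ::
    "('a, 'm) ring_scheme \<Rightarrow> nat \<Rightarrow> nat \<Rightarrow> (nat \<Rightarrow> 'a) \<Rightarrow> nat \<Rightarrow> nat \<Rightarrow> 'a set" where
  "W_sub R n t e i j = sum_of_family R ({1..t} - {j}) (top_component R n e i)"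

definition K_sub ::
    "('a, 'm) ring_scheme \<Rightarrow> nat \<Rightarrow> nat \<Rightarrow> (nat \<Rightarrow> 'a) \<Rightarrow> nat \<Rightarrow> nat \<Rightarrow> 'a set \<Rightarrow> 'a set" where
  "K_sub R n t e i j U = W_sub R n t e i j <+>\<^bsub>R\<^esub> U"

definition M_quot ::
    "('a, 'm) ring_scheme \<Rightarrow> nat \<Rightarrow> nat \<Rightarrow> (nat \<Rightarrow> 'a) \<Rightarrow> nat \<Rightarrow> nat \<Rightarrow> 'a set
      \<Rightarrow> ('a, 'a set) module" where
  "M_quot R n t e i j U = quotient_module (principal_module R (e i)) (K_sub R n t e i j U)"

end

theory Submission
  imports Defs
begin

text \<open>
  Write \<open>J\<close> for the radical and \<open>P = \<Lambda> e\<^sub>i\<close>.  Since \<open>J\<^sup>n = 0\<close>, the radical annihilates the top layer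
  \<open>J\<^sup>n\<^sup>-\<^sup>1 P\<close>.  Because the algebra is basic, \<open>e\<^sub>h \<Lambda> e\<^sub>l \<subseteq> J\<close> for \<open>h \<noteq> l\<close>, so the algebra acts on the
  top layer \<open>\<Oplus>\<^sub>h e\<^sub>h J\<^sup>n\<^sup>-\<^sup>1 P\<close> diagonally, on the \<open>j\<close>-th summand through the residue ring \<open>D\<^sub>j\<close>.  Now
  \<open>W\<^sub>j \<oplus> U\<close> is the set of those \<open>k\<close> in the top layer with \<open>e\<^sub>j k \<in> U\<close>
  (\<open>K_sub_conv\<close>), and as \<open>U\<close> is stable under \<open>D\<^sub>j\<close>, this set is stable under \<open>\<Lambda>\<close>.

  The inclusion \<open>e\<^sub>h \<Lambda> e\<^sub>l \<subseteq> J\<close> (\<open>basic_corner_radical\<close>) is where finite dimension is used.  An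
  element \<open>a\<close> of \<open>e\<^sub>h \<Lambda> e\<^sub>l\<close> outside \<open>J\<close> has a left multiple \<open>x\<close> that is not nilpotent.
  The chains of left and right multiples of the powers of \<open>x\<close> stabilise, which makes some
  multiple \<open>b x\<^sup>m\<close> a nonzero idempotent (\<open>idempotent_of_power\<close>).  Primitivity of \<open>e\<^sub>l\<close> and \<open>e\<^sub>h\<close>
  then yields a two-sided inverse of \<open>a\<close> between the two idempotents, and right multiplication
  by \<open>a\<close> is an isomorphism \<open>\<Lambda> e\<^sub>h \<cong> \<Lambda> e\<^sub>l\<close> (\<open>nonradical_corner_iso\<close>), excluded in a basic algebra.

  Finally, \<open>K\<^sub>U \<subseteq> J\<^sup>n\<^sup>-\<^sup>1 P \<subseteq> J\<^sup>d P\<close> for \<open>d < n\<close>, and \<open>J\<^sup>d (P/K\<^sub>U)\<close> is the image of \<open>J\<^sup>d P\<close>.  By the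
  third isomorphism theorem the truncations of \<open>P/K\<^sub>U\<close> are those of \<open>P\<close>.  The isomorphisms are
  given by flattening a set of cosets to its union, a formula that does not depend on \<open>d\<close> and
  commutes with the projections; so the whole towers are identified
  (\<open>same_truncation_tower_quotients\<close>).
\<close>

section \<open>Submodules and quotients of left modules\<close>

context left_module
begin

lemma smult_zero:
  assumes "x \<in> carrier M"
  shows "\<zero>\<^bsub>R\<^esub> \<odot>\<^bsub>M\<^esub> x = \<zero>\<^bsub>M\<^esub>"
proof -
  have "\<zero>\<^bsub>R\<^esub> \<odot>\<^bsub>M\<^esub> x \<oplus>\<^bsub>M\<^esub> \<zero>\<^bsub>R\<^esub> \<odot>\<^bsub>M\<^esub> x = \<zero>\<^bsub>R\<^esub> \<odot>\<^bsub>M\<^esub> x"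
    using smult_l_distr[of "\<zero>\<^bsub>R\<^esub>" "\<zero>\<^bsub>R\<^esub>" x] assms by simp
  then show ?thesis
    using smult_closed[OF R.zero_closed assms] by (simp add: M.add.l_cancel_one)
qed

lemma smult_r_zero:
  assumes "r \<in> carrier R"
  shows "r \<odot>\<^bsub>M\<^esub> \<zero>\<^bsub>M\<^esub> = \<zero>\<^bsub>M\<^esub>"
proof -
  have "r \<odot>\<^bsub>M\<^esub> \<zero>\<^bsub>M\<^esub> \<oplus>\<^bsub>M\<^esub> r \<odot>\<^bsub>M\<^esub> \<zero>\<^bsub>M\<^esub> = r \<odot>\<^bsub>M\<^esub> \<zero>\<^bsub>M\<^esub>"
    using smult_r_distr[of r "\<zero>\<^bsub>M\<^esub>" "\<zero>\<^bsub>M\<^esub>"] assms by simp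
  then show ?thesis
    using smult_closed[OF assms M.zero_closed] by (simp add: M.add.l_cancel_one)
qed

lemma smult_minus_one:
  assumes "x \<in> carrier M"
  shows "(\<ominus>\<^bsub>R\<^esub> \<one>\<^bsub>R\<^esub>) \<odot>\<^bsub>M\<^esub> x = \<ominus>\<^bsub>M\<^esub> x"
proof -
  have "(\<ominus>\<^bsub>R\<^esub> \<one>\<^bsub>R\<^esub>) \<odot>\<^bsub>M\<^esub> x \<oplus>\<^bsub>M\<^esub> x = (\<ominus>\<^bsub>R\<^esub> \<one>\<^bsub>R\<^esub> \<oplus>\<^bsub>R\<^esub> \<one>\<^bsub>R\<^esub>) \<odot>\<^bsub>M\<^esub> x"
    using assms by (simp add: smult_l_distr smult_one)
  then have "(\<ominus>\<^bsub>R\<^esub> \<one>\<^bsub>R\<^esub>) \<odot>\<^bsub>M\<^esub> x \<oplus>\<^bsub>M\<^esub> x = \<zero>\<^bsub>M\<^esub>"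
    using assms by (simp add: R.l_neg smult_zero)
  then show ?thesis
    using assms M.minus_equality smult_closed by simp
qed

lemma submodule_mem:
  assumes "submodule N R M"
  shows "N \<subseteq> carrier M" "\<zero>\<^bsub>M\<^esub> \<in> N"
    "\<And>x y. x \<in> N \<Longrightarrow> y \<in> N \<Longrightarrow> x \<oplus>\<^bsub>M\<^esub> y \<in> N"
    "\<And>x y. x \<in> N \<Longrightarrow> y \<in> N \<Longrightarrow> x \<ominus>\<^bsub>M\<^esub> y \<in> N"
    "\<And>r x. r \<in> carrier R \<Longrightarrow> x \<in> N \<Longrightarrow> r \<odot>\<^bsub>M\<^esub> x \<in> N"
proof -
  interpret N: submodule N R M by fact
  show sub: "N \<subseteq> carrier M" and "\<zero>\<^bsub>M\<^esub> \<in> N" using N.subset N.one_closed by simp_all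
  show add: "x \<oplus>\<^bsub>M\<^esub> y \<in> N" if "x \<in> N" "y \<in> N" for x y using N.m_closed that by simp
  show sm: "r \<odot>\<^bsub>M\<^esub> x \<in> N" if "r \<in> carrier R" "x \<in> N" for r x using that by simp
  show "x \<ominus>\<^bsub>M\<^esub> y \<in> N" if "x \<in> N" "y \<in> N" for x y
    using add[OF that(1) sm[of "\<ominus>\<^bsub>R\<^esub> \<one>\<^bsub>R\<^esub>" y]] that sub
    by (simp add: smult_minus_one a_minus_def subset_iff)
qed

lemma submoduleI:
  assumes "N \<subseteq> carrier M" "\<zero>\<^bsub>M\<^esub> \<in> N"
    and "\<And>x y. x \<in> N \<Longrightarrow> y \<in> N \<Longrightarrow> x \<oplus>\<^bsub>M\<^esub> y \<in> N"
    and sm: "\<And>r x. r \<in> carrier R \<Longrightarrow> x \<in> N \<Longrightarrow> r \<odot>\<^bsub>M\<^esub> x \<in> N"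
  shows "submodule N R M"
proof (intro submodule.intro submodule_axioms.intro)
  have "\<ominus>\<^bsub>M\<^esub> x \<in> N" if "x \<in> N" for x
    using sm[of "\<ominus>\<^bsub>R\<^esub> \<one>\<^bsub>R\<^esub>" x] that assms(1) by (simp add: smult_minus_one subset_iff)
  then show "subgroup N (add_monoid M)"
    using assms by (intro subgroup.intro) (auto simp flip: a_inv_def)
qed (fact sm)

lemma mem_coset_iff:
  assumes "submodule N R M" "x \<in> carrier M"
  shows "y \<in> N +>\<^bsub>M\<^esub> x \<longleftrightarrow> y \<in> carrier M \<and> y \<ominus>\<^bsub>M\<^esub> x \<in> N"
proof
  assume "y \<in> N +>\<^bsub>M\<^esub> x"
  then obtain h where "h \<in> N" "y = h \<oplus>\<^bsub>M\<^esub> x" by (auto simp: a_r_coset_def')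
  then show "y \<in> carrier M \<and> y \<ominus>\<^bsub>M\<^esub> x \<in> N"
    using assms submodule_mem(1)[OF assms(1)]
    by (auto simp: a_minus_def subset_iff M.a_assoc M.r_neg)
next
  assume y: "y \<in> carrier M \<and> y \<ominus>\<^bsub>M\<^esub> x \<in> N"
  then have "y = (y \<ominus>\<^bsub>M\<^esub> x) \<oplus>\<^bsub>M\<^esub> x"
    using assms(2) by (simp add: a_minus_def M.a_assoc M.l_neg)
  then show "y \<in> N +>\<^bsub>M\<^esub> x" using y by (auto simp: a_r_coset_def')
qed

lemma coset_self:
  assumes "submodule N R M" "x \<in> carrier M"
  shows "x \<in> N +>\<^bsub>M\<^esub> x"
  using assms submodule_mem(2)[OF assms(1)] by (simp add: mem_coset_iff M.r_neg a_minus_def)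

lemma coset_eq:
  assumes "submodule N R M" "x \<in> carrier M" "y \<in> N +>\<^bsub>M\<^esub> x"
  shows "N +>\<^bsub>M\<^esub> y = N +>\<^bsub>M\<^esub> x"
  using M.a_repr_independence[OF assms(3,2)] submodule.axioms(1)[OF assms(1)] by simp

lemma quotient_carrier: "carrier (quotient_module M N) = (\<lambda>x. N +>\<^bsub>M\<^esub> x) ` carrier M"
  by (auto simp: quotient_module_def A_RCOSETS_def')

lemma quotient_zero:
  assumes "submodule N R M"
  shows "\<zero>\<^bsub>quotient_module M N\<^esub> = N +>\<^bsub>M\<^esub> \<zero>\<^bsub>M\<^esub>"
  using submodule_mem(1)[OF assms] by (simp add: quotient_module_def M.a_coset_add_zero)

lemma quotient_add:
  assumes "submodule N R M" "x \<in> carrier M" "y \<in> carrier M"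
  shows "(N +>\<^bsub>M\<^esub> x) \<oplus>\<^bsub>quotient_module M N\<^esub> (N +>\<^bsub>M\<^esub> y) = N +>\<^bsub>M\<^esub> (x \<oplus>\<^bsub>M\<^esub> y)"
proof -
  interpret N: abelian_subgroup N M
    using submodule.axioms(1)[OF assms(1)]
    by (intro abelian_subgroupI3 additive_subgroupI M.abelian_group_axioms)
  show ?thesis using N.a_rcos_sum assms(2,3) by (simp add: quotient_module_def)
qed

lemma quotient_smult:
  assumes N: "submodule N R M" and r: "r \<in> carrier R" and x: "x \<in> carrier M"
  shows "r \<odot>\<^bsub>quotient_module M N\<^esub> (N +>\<^bsub>M\<^esub> x) = N +>\<^bsub>M\<^esub> (r \<odot>\<^bsub>M\<^esub> x)"
proof -
  have "N +>\<^bsub>M\<^esub> (r \<odot>\<^bsub>M\<^esub> y) = N +>\<^bsub>M\<^esub> (r \<odot>\<^bsub>M\<^esub> x)" if "y \<in> N +>\<^bsub>M\<^esub> x" for y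
  proof -
    obtain h where h: "h \<in> N" "y = h \<oplus>\<^bsub>M\<^esub> x" using \<open>y \<in> N +>\<^bsub>M\<^esub> x\<close> by (auto simp: a_r_coset_def')
    have "r \<odot>\<^bsub>M\<^esub> y = r \<odot>\<^bsub>M\<^esub> h \<oplus>\<^bsub>M\<^esub> r \<odot>\<^bsub>M\<^esub> x"
      using h r x submodule_mem(1)[OF N] by (simp add: smult_r_distr subset_iff)
    moreover have "r \<odot>\<^bsub>M\<^esub> h \<in> N" using h r by (simp add: submodule_mem(5)[OF N])
    ultimately have "r \<odot>\<^bsub>M\<^esub> y \<in> N +>\<^bsub>M\<^esub> (r \<odot>\<^bsub>M\<^esub> x)" by (auto simp: a_r_coset_def')
    then show ?thesis using coset_eq[OF N] smult_closed r x by simp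
  qed
  then have "(\<Union>y\<in>N +>\<^bsub>M\<^esub> x. N +>\<^bsub>M\<^esub> (r \<odot>\<^bsub>M\<^esub> y)) = N +>\<^bsub>M\<^esub> (r \<odot>\<^bsub>M\<^esub> x)"
    using coset_self[OF N x] by blast
  then show ?thesis by (simp add: quotient_module_def)
qed

text \<open>
  The elements of \<open>(M/N)/(L/N)\<close> are sets of cosets of \<open>N\<close>, and such a set consists of the
  pieces into which \<open>N\<close> cuts a coset of \<open>L\<close>.  Since the pieces of a saturated set reassemble to
  it, the third isomorphism theorem becomes a statement about flattening families of sets.
\<close>

lemma Union_cosets:
  assumes N: "submodule N R M" and A: "A \<subseteq> carrier M"
    and sat: "\<And>h a. h \<in> N \<Longrightarrow> a \<in> A \<Longrightarrow> h \<oplus>\<^bsub>M\<^esub> a \<in> A"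
  shows "\<Union>((\<lambda>x. N +>\<^bsub>M\<^esub> x) ` A) = A"
proof
  show "\<Union>((\<lambda>x. N +>\<^bsub>M\<^esub> x) ` A) \<subseteq> A" using sat by (auto simp: a_r_coset_def')
  show "A \<subseteq> \<Union>((\<lambda>x. N +>\<^bsub>M\<^esub> x) ` A)" using coset_self[OF N] A by blast
qed

lemma Union_cosets_of_coset:
  assumes N: "submodule N R M" and L: "submodule L R M" and NL: "N \<subseteq> L" and x: "x \<in> carrier M"
  shows "\<Union>((\<lambda>y. N +>\<^bsub>M\<^esub> y) ` (L +>\<^bsub>M\<^esub> x)) = L +>\<^bsub>M\<^esub> x"
proof (rule Union_cosets[OF N])
  show "L +>\<^bsub>M\<^esub> x \<subseteq> carrier M" using mem_coset_iff[OF L x] by blast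
  fix h a assume h: "h \<in> N" and "a \<in> L +>\<^bsub>M\<^esub> x"
  then obtain l where l: "l \<in> L" "a = l \<oplus>\<^bsub>M\<^esub> x" by (auto simp: a_r_coset_def')
  have "h \<oplus>\<^bsub>M\<^esub> a = (h \<oplus>\<^bsub>M\<^esub> l) \<oplus>\<^bsub>M\<^esub> x"
    using l h x NL submodule_mem(1)[OF L] by (simp add: M.a_assoc subset_iff)
  moreover have "h \<oplus>\<^bsub>M\<^esub> l \<in> L" using h l NL submodule_mem(3)[OF L] by blast
  ultimately show "h \<oplus>\<^bsub>M\<^esub> a \<in> L +>\<^bsub>M\<^esub> x" by (auto simp: a_r_coset_def')
qed

lemma set_add_cosets:
  assumes N: "submodule N R M" and A: "A \<subseteq> carrier M" and B: "B \<subseteq> carrier M"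
  shows "((\<lambda>x. N +>\<^bsub>M\<^esub> x) ` A) <+>\<^bsub>quotient_module M N\<^esub> ((\<lambda>x. N +>\<^bsub>M\<^esub> x) ` B)
    = (\<lambda>x. N +>\<^bsub>M\<^esub> x) ` (A <+>\<^bsub>M\<^esub> B)"
proof -
  have "(N +>\<^bsub>M\<^esub> a) \<oplus>\<^bsub>quotient_module M N\<^esub> (N +>\<^bsub>M\<^esub> b) = N +>\<^bsub>M\<^esub> (a \<oplus>\<^bsub>M\<^esub> b)"
    if "a \<in> A" "b \<in> B" for a b using quotient_add[OF N] that A B by blast
  then show ?thesis by (auto simp: set_add_def')
qed

lemma submodule_image_quotient:
  assumes N: "submodule N R M" and L: "submodule L R M"
  shows "submodule ((\<lambda>x. N +>\<^bsub>M\<^esub> x) ` L) R (quotient_module M N)"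
proof -
  interpret Q: left_module R "quotient_module M N" by (rule quotient_left_module[OF N])
  note sub = subsetD[OF submodule_mem(1)[OF L]]
  show ?thesis
  proof (rule Q.submoduleI)
    show "(\<lambda>x. N +>\<^bsub>M\<^esub> x) ` L \<subseteq> carrier (quotient_module M N)"
      using sub by (auto simp: quotient_carrier)
  qed (auto simp: quotient_zero[OF N] quotient_add[OF N] quotient_smult[OF N] sub
        submodule_mem[OF L])
qed

lemma coset_of_cosets:
  assumes N: "submodule N R M" and L: "submodule L R M" and x: "x \<in> carrier M"
  shows "((\<lambda>y. N +>\<^bsub>M\<^esub> y) ` L) +>\<^bsub>quotient_module M N\<^esub> (N +>\<^bsub>M\<^esub> x)
    = (\<lambda>y. N +>\<^bsub>M\<^esub> y) ` (L +>\<^bsub>M\<^esub> x)"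
  using set_add_cosets[OF N submodule_mem(1)[OF L], of "{x}"] x
  by (simp add: a_r_coset_def' set_add_def')

text \<open>
  The third isomorphism theorem \<open>(M/N)/(L/N) \<cong> M/L\<close>.  Explicit maps in both directions, rather
  than the mere existence of an isomorphism, are what makes compatibility with the projections of
  the truncation towers checkable later on.
\<close>

lemma third_iso:
  assumes N: "submodule N R M" and L: "submodule L R M" and NL: "N \<subseteq> L"
  defines "c \<equiv> \<lambda>x. N +>\<^bsub>M\<^esub> x"
  shows "Union \<in> left_module_iso_maps R (quotient_module (quotient_module M N) (c ` L)) (quotient_module M L)"
    and "(`) c \<in> left_module_iso_maps R (quotient_module M L) (quotient_module (quotient_module M N) (c ` L))"
proof -
  interpret Q: left_module R "quotient_module M N" by (rule quotient_left_module[OF N])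
  let ?Q = "quotient_module (quotient_module M N) (c ` L)"
  have cL: "submodule (c ` L) R (quotient_module M N)"
    unfolding c_def by (rule submodule_image_quotient[OF N L])
  have cc: "c ` L +>\<^bsub>quotient_module M N\<^esub> c x = c ` (L +>\<^bsub>M\<^esub> x)" if "x \<in> carrier M" for x
    using coset_of_cosets[OF N L that] by (simp add: c_def)
  have ccar: "c x \<in> carrier (quotient_module M N)" if "x \<in> carrier M" for x
    using that by (auto simp: quotient_carrier c_def)
  have U: "\<Union>(c ` A) = A" if "A \<in> carrier (quotient_module M L)" for A
    using that Union_cosets_of_coset[OF N L NL] by (auto simp: quotient_carrier c_def)
  have "carrier ?Q = (\<lambda>x. c ` L +>\<^bsub>quotient_module M N\<^esub> c x) ` carrier M"
    by (simp add: Q.quotient_carrier quotient_carrier image_image c_def)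
  then have car: "carrier ?Q = (`) c ` carrier (quotient_module M L)"
    by (simp add: cc quotient_carrier image_image)
  have add: "c ` A \<oplus>\<^bsub>?Q\<^esub> c ` B = c ` (A \<oplus>\<^bsub>quotient_module M L\<^esub> B)"
    if A: "A \<in> carrier (quotient_module M L)" and B: "B \<in> carrier (quotient_module M L)" for A B
  proof -
    obtain x y where xy: "x \<in> carrier M" "y \<in> carrier M" "A = L +>\<^bsub>M\<^esub> x" "B = L +>\<^bsub>M\<^esub> y"
      using A B by (auto simp: quotient_carrier)
    have "c x \<oplus>\<^bsub>quotient_module M N\<^esub> c y = c (x \<oplus>\<^bsub>M\<^esub> y)"
      using xy by (simp add: c_def quotient_add[OF N])
    then show ?thesis
      using xy Q.quotient_add[OF cL ccar ccar, of x y]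
      by (simp add: cc quotient_add[OF L])
  qed
  have sm: "r \<odot>\<^bsub>?Q\<^esub> c ` A = c ` (r \<odot>\<^bsub>quotient_module M L\<^esub> A)"
    if r: "r \<in> carrier R" and A: "A \<in> carrier (quotient_module M L)" for r A
  proof -
    obtain x where x: "x \<in> carrier M" "A = L +>\<^bsub>M\<^esub> x"
      using A by (auto simp: quotient_carrier)
    have "r \<odot>\<^bsub>quotient_module M N\<^esub> c x = c (r \<odot>\<^bsub>M\<^esub> x)"
      using x r by (simp add: c_def quotient_smult[OF N])
    then show ?thesis
      using x r Q.quotient_smult[OF cL r ccar, of x]
      by (simp add: cc quotient_smult[OF L] smult_closed)
  qed
  interpret QL: left_module R "quotient_module M L" by (rule quotient_left_module[OF L])
  have "bij_betw Union (carrier ?Q) (carrier (quotient_module M L))"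
    by (rule bij_betw_byWitness[where f' = "(`) c"]) (auto simp: car U)
  then show "Union \<in> left_module_iso_maps R ?Q (quotient_module M L)"
    by (auto simp: left_module_iso_maps_def car add sm U QL.smult_closed)
  have "bij_betw ((`) c) (carrier (quotient_module M L)) (carrier ?Q)"
    by (rule bij_betw_byWitness[where f' = Union]) (auto simp: car U)
  then show "(`) c \<in> left_module_iso_maps R (quotient_module M L) ?Q"
    by (auto simp: left_module_iso_maps_def add sm)
qed

end

lemma left_module_iso_maps_comp:
  assumes f: "f \<in> left_module_iso_maps R M N" and g: "g \<in> left_module_iso_maps R N P"
  shows "g \<circ> f \<in> left_module_iso_maps R M P"
proof -
  have "f x \<in> carrier N" if "x \<in> carrier M" for x
    using f that by (auto simp: left_module_iso_maps_def bij_betw_def)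
  then show ?thesis
    using f g by (auto simp: left_module_iso_maps_def intro: bij_betw_trans)
qed

section \<open>Radical submodules and truncations\<close>

context left_module
begin

lemma ideal_smult_submodule:
  assumes I: "submodule I R (regular_module R)"
  shows "submodule (ideal_smult M I) R M"
proof -
  interpret L: left_module R "regular_module R" by (rule R.left_module_regular)
  have IR: "I \<subseteq> carrier R" using L.submodule_mem(1)[OF I] by (simp add: regular_module_def)
  have IL: "r \<otimes>\<^bsub>R\<^esub> a \<in> I" if "r \<in> carrier R" "a \<in> I" for r a
    using L.submodule_mem(5)[OF I that] by (simp add: regular_module_def)
  have sub: "x \<in> carrier M" if "x \<in> ideal_smult M I" for x
    using that by induction (use IR smult_closed in auto)
  show ?thesis
  proof (rule submoduleI)
    fix r x assume r: "r \<in> carrier R" and "x \<in> ideal_smult M I"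
    from this(2) show "r \<odot>\<^bsub>M\<^esub> x \<in> ideal_smult M I"
    proof induction
      case zero
      show ?case using r by (simp add: smult_r_zero ideal_smult.zero)
    next
      case (smult a x)
      then have "r \<odot>\<^bsub>M\<^esub> (a \<odot>\<^bsub>M\<^esub> x) = (r \<otimes>\<^bsub>R\<^esub> a) \<odot>\<^bsub>M\<^esub> x"
        using r IR by (auto simp: smult_assoc1)
      then show ?case using smult r IL by (auto intro: ideal_smult.smult)
    next
      case (sum x y)
      then show ?case using sub r by (auto simp: smult_r_distr intro: ideal_smult.sum)
    qed
  qed (auto intro: ideal_smult.zero ideal_smult.sum sub)
qed

lemma ideal_smult_quotient:
  assumes N: "submodule N R M" and I: "submodule I R (regular_module R)"
  shows "ideal_smult (quotient_module M N) I = (\<lambda>x. N +>\<^bsub>M\<^esub> x) ` ideal_smult M I"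
proof
  interpret L: left_module R "regular_module R" by (rule R.left_module_regular)
  have IR: "a \<in> carrier R" if "a \<in> I" for a
    using L.submodule_mem(1)[OF I] that by (auto simp: regular_module_def)
  have sub: "x \<in> carrier M" if "x \<in> ideal_smult M I" for x
    using submodule_mem(1)[OF ideal_smult_submodule[OF I]] that by blast
  show "ideal_smult (quotient_module M N) I \<subseteq> (\<lambda>x. N +>\<^bsub>M\<^esub> x) ` ideal_smult M I"
  proof
    fix X assume "X \<in> ideal_smult (quotient_module M N) I"
    then show "X \<in> (\<lambda>x. N +>\<^bsub>M\<^esub> x) ` ideal_smult M I"
    proof induction
      case zero
      show ?case using ideal_smult.zero by (auto simp: quotient_zero[OF N])
    next
      case (smult a X)
      then obtain x where "x \<in> carrier M" "X = N +>\<^bsub>M\<^esub> x" by (auto simp: quotient_carrier)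
      then show ?case using smult IR by (auto simp: quotient_smult[OF N] intro: ideal_smult.smult)
    next
      case (sum X Y)
      then show ?case using sub by (auto simp: quotient_add[OF N] intro: ideal_smult.sum)
    qed
  qed
  have "N +>\<^bsub>M\<^esub> x \<in> ideal_smult (quotient_module M N) I" if "x \<in> ideal_smult M I" for x
    using that
  proof induction
    case zero
    show ?case using ideal_smult.zero[of "quotient_module M N"] by (simp add: quotient_zero[OF N])
  next
    case (smult a x)
    have "a \<odot>\<^bsub>quotient_module M N\<^esub> (N +>\<^bsub>M\<^esub> x) \<in> ideal_smult (quotient_module M N) I"
      using smult by (intro ideal_smult.smult) (auto simp: quotient_carrier)
    then show ?case using smult IR by (simp add: quotient_smult[OF N])
  next
    case (sum x y)
    then have "(N +>\<^bsub>M\<^esub> x) \<oplus>\<^bsub>quotient_module M N\<^esub> (N +>\<^bsub>M\<^esub> y) \<in> ideal_smult (quotient_module M N) I"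
      by (intro ideal_smult.sum)
    then show ?case using sum sub by (simp add: quotient_add[OF N])
  qed
  then show "(\<lambda>x. N +>\<^bsub>M\<^esub> x) ` ideal_smult M I \<subseteq> ideal_smult (quotient_module M N) I" by blast
qed

end

context ring
begin

lemma jacobson_radical_left_ideal: "submodule (jacobson_radical R) R (regular_module R)"
proof -
  interpret L: left_module R "regular_module R" by (rule left_module_regular)
  have max: "submodule I R (regular_module R)" if "maximal_left_ideal I R" for I
    using that by (simp add: maximal_left_ideal_def)
  show ?thesis
  proof (rule L.submoduleI)
    show "jacobson_radical R \<subseteq> carrier (regular_module R)"
      by (auto simp: jacobson_radical_def regular_module_def)
  qed (use L.submodule_mem[OF max] in \<open>auto simp: jacobson_radical_def regular_module_def\<close>)
qed

lemma ideal_power_left_ideal: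
  assumes I: "submodule I R (regular_module R)"
  shows "submodule (ideal_power R I m) R (regular_module R)"
proof (induction m)
  interpret L: left_module R "regular_module R" by (rule left_module_regular)
  have IR: "a \<in> carrier R" if "a \<in> I" for a
    using L.submodule_mem(1)[OF I] that by (auto simp: regular_module_def)
  have IL: "r \<otimes> a \<in> I" if "r \<in> carrier R" "a \<in> I" for r a
    using L.submodule_mem(5)[OF I that] by (simp add: regular_module_def)
  { case 0
    show ?case by (rule L.submoduleI) (auto simp: regular_module_def)
  next
    case (Suc m)
    let ?P = "ideal_power R I m"
    have PR: "a \<in> carrier R" if "a \<in> ?P" for a
      using L.submodule_mem(1)[OF Suc] that by (auto simp: regular_module_def)
    have sub: "x \<in> carrier R" if "x \<in> ideal_prod R I ?P" for x
      using that by induction (auto simp: IR PR)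
    have mult: "r \<otimes> x \<in> ideal_prod R I ?P" if r: "r \<in> carrier R" and x: "x \<in> ideal_prod R I ?P" for r x
      using x
    proof induction
      case (prod a b)
      then have "r \<otimes> (a \<otimes> b) = (r \<otimes> a) \<otimes> b" using r IR PR by (simp add: m_assoc)
      then show ?case using prod r IL by (auto intro: ideal_prod.prod)
    next
      case (sum x y)
      then show ?case using r sub by (auto simp: r_distr intro: ideal_prod.sum)
    qed
    have "\<zero> \<otimes> \<zero> \<in> ideal_prod R I ?P"
      using L.submodule_mem(2)[OF I] L.submodule_mem(2)[OF Suc]
      by (intro ideal_prod.prod) (auto simp: regular_module_def)
    then show ?case
      by (intro L.submoduleI) (auto simp: regular_module_def sub mult ideal_prod.sum)
  }
qed

lemma ideal_power_antimono:
  assumes I: "submodule I R (regular_module R)" and "d \<le> m"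
  shows "ideal_power R I m \<subseteq> ideal_power R I d"
  using \<open>d \<le> m\<close>
proof (induction rule: dec_induct)
  case (step m)
  interpret L: left_module R "regular_module R" by (rule left_module_regular)
  note P = L.submodule_mem[OF ideal_power_left_ideal[OF I, of m]]
  have "x \<in> ideal_power R I m" if "x \<in> ideal_prod R I (ideal_power R I m)" for x
    using that
  proof induction
    case (prod a b)
    then show ?case using P(5)[of a b] L.submodule_mem(1)[OF I] by (auto simp: regular_module_def)
  next
    case (sum x y)
    then show ?case using P(3)[of x y] by (simp add: regular_module_def)
  qed
  then show ?case using step by auto
qed simp

end

lemma ideal_smult_mono: "I \<subseteq> I' \<Longrightarrow> ideal_smult M I \<subseteq> ideal_smult M I'"
proof
  fix x assume "I \<subseteq> I'" "x \<in> ideal_smult M I"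
  from this(2) show "x \<in> ideal_smult M I'"
    by induction (use \<open>I \<subseteq> I'\<close> in \<open>auto intro: ideal_smult.intros\<close>)
qed

context left_module
begin

lemma radical_submodule_submodule: "submodule (radical_submodule R M d) R M"
  unfolding radical_submodule_def
  by (intro ideal_smult_submodule R.ideal_power_left_ideal R.jacobson_radical_left_ideal)

lemma radical_submodule_antimono:
  "d \<le> m \<Longrightarrow> radical_submodule R M m \<subseteq> radical_submodule R M d"
  unfolding radical_submodule_def
  by (intro ideal_smult_mono R.ideal_power_antimono R.jacobson_radical_left_ideal)

lemma radical_submodule_quotient:
  assumes "submodule N R M"
  shows "radical_submodule R (quotient_module M N) d = (\<lambda>x. N +>\<^bsub>M\<^esub> x) ` radical_submodule R M d"
  unfolding radical_submodule_def
  by (intro ideal_smult_quotient assms R.ideal_power_left_ideal R.jacobson_radical_left_ideal)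

text \<open>
  The image of \<open>J\<^sup>d M\<close> in \<open>M/N\<close> is \<open>J\<^sup>d (M/N)\<close>, so this is the third isomorphism theorem for
  \<open>L = J\<^sup>d M\<close>.
\<close>

lemma radical_truncation_quotient:
  assumes N: "submodule N R M" and "N \<subseteq> radical_submodule R M d"
  shows "Union \<in> left_module_iso_maps R
      (radical_truncation R (quotient_module M N) d) (radical_truncation R M d)"
    and "(`) (\<lambda>x. N +>\<^bsub>M\<^esub> x) \<in> left_module_iso_maps R
      (radical_truncation R M d) (radical_truncation R (quotient_module M N) d)"
  unfolding radical_truncation_def radical_submodule_quotient[OF N]
  using third_iso[OF N radical_submodule_submodule assms(2)] by auto

text \<open>
  Both towers are identified with that of \<open>M\<close>: the comparison map takes the union of a family of
  \<open>N\<close>-cosets and cuts it into \<open>N'\<close>-cosets, by the same formula in every degree.  It commutes with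
  the projections because on the level of unions a projection adds \<open>J\<^sup>d M\<close> on either side.
\<close>

lemma same_truncation_tower_quotients:
  assumes N: "submodule N R M" and N': "submodule N' R M"
    and le: "\<And>d. d < n \<Longrightarrow> N \<subseteq> radical_submodule R M d"
    and le': "\<And>d. d < n \<Longrightarrow> N' \<subseteq> radical_submodule R M d"
  shows "same_proper_truncation_tower R n (quotient_module M N) (quotient_module M N')"
proof -
  define c where "c = (\<lambda>x. N +>\<^bsub>M\<^esub> x)"
  define c' where "c' = (\<lambda>x. N' +>\<^bsub>M\<^esub> x)"
  define \<phi> where "\<phi> = (\<lambda>X. c' ` \<Union>X)"
  let ?L = "radical_submodule R M"
  have iso: "\<phi> \<in> left_module_iso_maps R (radical_truncation R (quotient_module M N) d)
      (radical_truncation R (quotient_module M N') d)" if "d < n" for d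
    using left_module_iso_maps_comp[OF radical_truncation_quotient(1)[OF N le[OF that]]
        radical_truncation_quotient(2)[OF N' le'[OF that]]]
    by (simp add: \<phi>_def c'_def comp_def)
  have comm: "\<phi> (truncation_proj R (quotient_module M N) d X)
      = truncation_proj R (quotient_module M N') d (\<phi> X)"
    if d: "d + 1 < n" and X: "X \<in> carrier (radical_truncation R (quotient_module M N) (d + 1))"
    for d X
  proof -
    note L = radical_submodule_submodule
    have "\<Union>X \<in> carrier (radical_truncation R M (d + 1))"
      using radical_truncation_quotient(1)[OF N le[OF d]] X
      by (auto simp: left_module_iso_maps_def bij_betw_def)
    then obtain x where x: "x \<in> carrier M" "\<Union>X = ?L (d + 1) +>\<^bsub>M\<^esub> x"
      by (auto simp: radical_truncation_def quotient_carrier)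
    have UX: "\<Union>X \<subseteq> carrier M" unfolding x(2) using mem_coset_iff[OF L x(1)] by blast
    have bij: "bij_betw Union (carrier (radical_truncation R (quotient_module M N) (d + 1)))
        (carrier (radical_truncation R M (d + 1)))"
      using radical_truncation_quotient(1)[OF N le[OF d]] by (simp add: left_module_iso_maps_def)
    have "c ` (?L (d + 1) +>\<^bsub>M\<^esub> x) \<in> carrier (radical_truncation R (quotient_module M N) (d + 1))"
      using radical_truncation_quotient(2)[OF N le[OF d]] x(1)
      by (auto simp: left_module_iso_maps_def bij_betw_def c_def radical_truncation_def quotient_carrier)
    moreover have "\<Union>(c ` (?L (d + 1) +>\<^bsub>M\<^esub> x)) = \<Union>X"
      using Union_cosets_of_coset[OF N L le[OF d] x(1)] x(2) by (simp add: c_def)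
    \<comment> \<open>Two cosets in \<open>(M/N)/(J\<^sup>d\<^sup>+\<^sup>1 M/N)\<close> with the same union coincide.\<close>
    ultimately have Xc: "X = c ` \<Union>X"
      using bij X x(2) by (metis bij_betw_def inj_onD)
    have LX: "?L d <+>\<^bsub>M\<^esub> \<Union>X \<subseteq> carrier M"
      using UX submodule_mem(1)[OF L[of d]] M.a_closed unfolding set_add_def' by blast
    have "\<Union>(c ` (?L d <+>\<^bsub>M\<^esub> \<Union>X)) = ?L d <+>\<^bsub>M\<^esub> \<Union>X"
      unfolding c_def
    proof (rule Union_cosets[OF N LX])
      fix h a assume h: "h \<in> N" and "a \<in> ?L d <+>\<^bsub>M\<^esub> \<Union>X"
      then obtain l z where lz: "l \<in> ?L d" "z \<in> \<Union>X" "a = l \<oplus>\<^bsub>M\<^esub> z" by (auto simp: set_add_def')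
      have hL: "h \<in> ?L d" using h le[of d] d by auto
      then have "h \<oplus>\<^bsub>M\<^esub> a = (h \<oplus>\<^bsub>M\<^esub> l) \<oplus>\<^bsub>M\<^esub> z"
        using lz UX submodule_mem(1)[OF L[of d]] by (simp add: M.a_assoc subset_iff)
      then show "h \<oplus>\<^bsub>M\<^esub> a \<in> ?L d <+>\<^bsub>M\<^esub> \<Union>X"
        using submodule_mem(3)[OF L hL lz(1)] lz(2) unfolding set_add_def' by blast
    qed
    moreover have "truncation_proj R (quotient_module M N) d X = c ` (?L d <+>\<^bsub>M\<^esub> \<Union>X)"
      unfolding truncation_proj_def radical_submodule_quotient[OF N]
      by (subst Xc) (simp add: c_def set_add_cosets[OF N submodule_mem(1)[OF L] UX])
    moreover have "truncation_proj R (quotient_module M N') d (\<phi> X) = c' ` (?L d <+>\<^bsub>M\<^esub> \<Union>X)"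
      unfolding truncation_proj_def radical_submodule_quotient[OF N'] \<phi>_def c'_def
      by (rule set_add_cosets[OF N' submodule_mem(1)[OF L] UX])
    ultimately show ?thesis by (simp add: \<phi>_def)
  qed
  show ?thesis
    unfolding same_proper_truncation_tower_def
  proof (intro exI[of _ "\<lambda>_. \<phi>"] conjI allI impI ballI)
    fix d assume "1 \<le> d \<and> d < n"
    then show "\<phi> \<in> left_module_iso_maps R (radical_truncation R (quotient_module M N) d)
      (radical_truncation R (quotient_module M N') d)" using iso by simp
  next
    fix d X assume "1 \<le> d \<and> d + 1 < n"
      and "X \<in> carrier (radical_truncation R (quotient_module M N) (d + 1))"
    then show "\<phi> (truncation_proj R (quotient_module M N) d X)
      = truncation_proj R (quotient_module M N') d (\<phi> X)" using comm by blast
  qed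
qed

end

section \<open>Strong pi-regularity of finite-dimensional algebras\<close>

context left_module
begin

lemma module_span_submodule:
  assumes "B \<subseteq> carrier M"
  shows "submodule (module_span R M B) R M"
proof -
  have "submodule (carrier M) R M" by (rule submoduleI) (auto simp: smult_closed)
  then have "module_span R M B \<subseteq> carrier M" using assms by (auto simp: module_span_def)
  then show ?thesis
    by (rule submoduleI) (auto simp: module_span_def submodule_mem)
qed

lemma span_insert_subset:
  assumes b: "b \<in> carrier M" and B: "B \<subseteq> carrier M" and x: "x \<in> module_span R M (insert b B)"
  shows "\<exists>a\<in>carrier R. \<exists>w\<in>module_span R M B. x = a \<odot>\<^bsub>M\<^esub> b \<oplus>\<^bsub>M\<^esub> w"
proof -
  let ?S = "{a \<odot>\<^bsub>M\<^esub> b \<oplus>\<^bsub>M\<^esub> w | a w. a \<in> carrier R \<and> w \<in> module_span R M B}"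
  have sp: "submodule (module_span R M B) R M" by (rule module_span_submodule[OF B])
  note spm = submodule_mem[OF sp]
  have spc: "w \<in> carrier M" if "w \<in> module_span R M B" for w using spm(1) that by blast
  have "submodule ?S R M"
  proof (rule submoduleI)
    show "\<zero>\<^bsub>M\<^esub> \<in> ?S"
      using spm(2) b by (intro CollectI exI[of _ "\<zero>\<^bsub>R\<^esub>"] exI[of _ "\<zero>\<^bsub>M\<^esub>"]) (simp add: smult_zero)
    fix x y assume "x \<in> ?S" "y \<in> ?S"
    then obtain a w a' w' where *: "a \<in> carrier R" "a' \<in> carrier R" "w \<in> module_span R M B"
      "w' \<in> module_span R M B" "x = a \<odot>\<^bsub>M\<^esub> b \<oplus>\<^bsub>M\<^esub> w" "y = a' \<odot>\<^bsub>M\<^esub> b \<oplus>\<^bsub>M\<^esub> w'" by blast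
    then have "x \<oplus>\<^bsub>M\<^esub> y = (a \<oplus>\<^bsub>R\<^esub> a') \<odot>\<^bsub>M\<^esub> b \<oplus>\<^bsub>M\<^esub> (w \<oplus>\<^bsub>M\<^esub> w')"
      using b spc smult_closed by (simp add: smult_l_distr M.a_ac)
    then show "x \<oplus>\<^bsub>M\<^esub> y \<in> ?S" using * spm(3) by blast
  next
    fix r x assume r: "r \<in> carrier R" and "x \<in> ?S"
    then obtain a w where *: "a \<in> carrier R" "w \<in> module_span R M B" "x = a \<odot>\<^bsub>M\<^esub> b \<oplus>\<^bsub>M\<^esub> w" by blast
    then have "r \<odot>\<^bsub>M\<^esub> x = (r \<otimes>\<^bsub>R\<^esub> a) \<odot>\<^bsub>M\<^esub> b \<oplus>\<^bsub>M\<^esub> (r \<odot>\<^bsub>M\<^esub> w)"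
      using b spc smult_closed r by (simp add: smult_r_distr smult_assoc1)
    then show "r \<odot>\<^bsub>M\<^esub> x \<in> ?S" using * r spm(5) by blast
  qed (use b spc smult_closed in auto)
  moreover have "b \<in> ?S"
    using b spm(2) by (intro CollectI exI[of _ "\<one>\<^bsub>R\<^esub>"] exI[of _ "\<zero>\<^bsub>M\<^esub>"]) (simp add: smult_one)
  moreover have "B \<subseteq> ?S"
  proof
    fix w assume w: "w \<in> B"
    then have "w \<in> module_span R M B" by (auto simp: module_span_def)
    with w B b show "w \<in> ?S"
      by (intro CollectI exI[of _ "\<zero>\<^bsub>R\<^esub>"] exI[of _ w]) (auto simp: smult_zero)
  qed
  ultimately have "module_span R M (insert b B) \<subseteq> ?S"
    unfolding module_span_def[of R M "insert b B"] by blast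
  then show ?thesis using x by blast
qed

text \<open>
  Induction on the spanning set avoids any theory of dimension.  In the inductive step, either
  some \<open>S m\<close> already lies in the span of the smaller set,
  or every \<open>S m\<close> contains an element with coefficient \<open>1\<close> at the extra generator \<open>b\<close>; in the
  second case elements of \<open>S m\<close> can be corrected by such an element of \<open>S k\<close> to lie in the
  intersections with the smaller span, which stabilise.
\<close>

lemma subspace_chain_stabilises:
  assumes F: "field R" and "finite B" "B \<subseteq> carrier M"
    and "\<And>m. submodule (S (m::nat)) R M" "antimono S" "\<And>m. S m \<subseteq> module_span R M B"
  shows "\<exists>m. \<forall>k\<ge>m. S k = S m"
  using assms(2-)
proof (induction B arbitrary: S rule: finite_induct)
  case empty
  have "submodule {\<zero>\<^bsub>M\<^esub>} R M"
    by (rule submoduleI) (auto simp: smult_r_zero)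
  then have "module_span R M {} \<subseteq> {\<zero>\<^bsub>M\<^esub>}" by (auto simp: module_span_def)
  then have "S m = {\<zero>\<^bsub>M\<^esub>}" for m
    using empty.prems(4)[of m] submodule_mem(2)[OF empty.prems(2)[of m]] by blast
  then show ?case by simp
next
  case (insert b B)
  interpret F: field R by (rule F)
  have b: "b \<in> carrier M" and B: "B \<subseteq> carrier M" using insert.prems(1) by auto
  have sp: "submodule (module_span R M B) R M" by (rule module_span_submodule[OF B])
  note spm = submodule_mem[OF sp] and Sm = submodule_mem[OF insert.prems(2)]
  have Sc: "x \<in> carrier M" if "x \<in> S m" for x m using Sm(1) that by blast
  have spc: "w \<in> carrier M" if "w \<in> module_span R M B" for w using spm(1) that by blast
  show ?case
  proof (cases "\<exists>p. S p \<subseteq> module_span R M B")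
    case True
    then obtain p where p: "S p \<subseteq> module_span R M B" by blast
    have "\<exists>m. \<forall>k\<ge>m. S (p + k) = S (p + m)"
    proof (rule insert.IH[OF B])
      show "antimono (\<lambda>k. S (p + k))" using insert.prems(3) by (auto simp: antimono_def)
      show "S (p + m) \<subseteq> module_span R M B" for m
        using antimonoD[OF insert.prems(3), of p "p + m"] p by auto
    qed (rule insert.prems)
    then obtain m where m: "\<And>k. k \<ge> m \<Longrightarrow> S (p + k) = S (p + m)" by blast
    have "S k = S (p + m)" if "k \<ge> p + m" for k using m[of "k - p"] that by simp
    then show ?thesis by blast
  next
    case False
    \<comment> \<open>An element of \<open>S k\<close> outside the smaller span, scaled to coefficient \<open>1\<close> at \<open>b\<close>.\<close>
    have unit: "\<exists>y\<in>S k. \<exists>w\<in>module_span R M B. y = b \<oplus>\<^bsub>M\<^esub> w" for k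
    proof -
      obtain z where z: "z \<in> S k" "z \<notin> module_span R M B" using False by blast
      obtain a w where aw: "a \<in> carrier R" "w \<in> module_span R M B" "z = a \<odot>\<^bsub>M\<^esub> b \<oplus>\<^bsub>M\<^esub> w"
        using span_insert_subset[OF b B] insert.prems(4) z(1) by blast
      have "a \<noteq> \<zero>\<^bsub>R\<^esub>" using aw z(2) b spc by (auto simp: smult_zero)
      then have inv: "inv\<^bsub>R\<^esub> a \<in> carrier R" "inv\<^bsub>R\<^esub> a \<otimes>\<^bsub>R\<^esub> a = \<one>\<^bsub>R\<^esub>"
        using aw(1) F.field_Units by auto
      have "inv\<^bsub>R\<^esub> a \<odot>\<^bsub>M\<^esub> z = b \<oplus>\<^bsub>M\<^esub> inv\<^bsub>R\<^esub> a \<odot>\<^bsub>M\<^esub> w"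
        using aw inv b spc smult_closed by (simp add: smult_r_distr smult_one flip: smult_assoc1)
      then show ?thesis using Sm(5)[OF inv(1) z(1)] spm(5)[OF inv(1) aw(2)] by blast
    qed
    have "\<exists>m. \<forall>k\<ge>m. S k \<inter> module_span R M B = S m \<inter> module_span R M B"
    proof (rule insert.IH[OF B])
      show "antimono (\<lambda>k. S k \<inter> module_span R M B)" using insert.prems(3) by (auto simp: antimono_def)
      show "submodule (S m \<inter> module_span R M B) R M" for m
        by (rule submoduleI) (use Sm spm in auto)
    qed auto
    then obtain m where m: "\<And>k. k \<ge> m \<Longrightarrow> S k \<inter> module_span R M B = S m \<inter> module_span R M B"
      by blast
    have "x \<in> S k" if k: "k \<ge> m" and x: "x \<in> S m" for k x
    proof -
      obtain y w where y: "y \<in> S k" "w \<in> module_span R M B" "y = b \<oplus>\<^bsub>M\<^esub> w" using unit by blast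
      obtain a v where a: "a \<in> carrier R" "v \<in> module_span R M B" "x = a \<odot>\<^bsub>M\<^esub> b \<oplus>\<^bsub>M\<^esub> v"
        using span_insert_subset[OF b B] insert.prems(4) x by blast
      have ay: "a \<odot>\<^bsub>M\<^esub> y \<in> S k" by (rule Sm(5)[OF a(1) y(1)])
      have aw: "a \<odot>\<^bsub>M\<^esub> w \<in> module_span R M B" by (rule spm(5)[OF a(1) y(2)])
      have c: "a \<odot>\<^bsub>M\<^esub> b \<in> carrier M" "v \<in> carrier M" "a \<odot>\<^bsub>M\<^esub> w \<in> carrier M"
        using b a y smult_closed spc by auto
      have "x = a \<odot>\<^bsub>M\<^esub> y \<oplus>\<^bsub>M\<^esub> (v \<ominus>\<^bsub>M\<^esub> a \<odot>\<^bsub>M\<^esub> w)"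
      proof -
        have "a \<odot>\<^bsub>M\<^esub> y = a \<odot>\<^bsub>M\<^esub> b \<oplus>\<^bsub>M\<^esub> a \<odot>\<^bsub>M\<^esub> w" using y a b spc by (simp add: smult_r_distr)
        then show ?thesis using a(3) c by (simp add: a_minus_def M.a_assoc M.a_lcomm[of "a \<odot>\<^bsub>M\<^esub> w" v] M.r_neg)
      qed
      moreover have "v \<ominus>\<^bsub>M\<^esub> a \<odot>\<^bsub>M\<^esub> w \<in> S m"
      proof -
        have "a \<odot>\<^bsub>M\<^esub> y \<in> S m" using ay antimonoD[OF insert.prems(3) k] by blast
        then have "x \<ominus>\<^bsub>M\<^esub> a \<odot>\<^bsub>M\<^esub> y \<in> S m" using Sm(4) x by blast
        moreover have "x \<ominus>\<^bsub>M\<^esub> a \<odot>\<^bsub>M\<^esub> y = v \<ominus>\<^bsub>M\<^esub> a \<odot>\<^bsub>M\<^esub> w"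
          using Sc[OF ay] c unfolding \<open>x = a \<odot>\<^bsub>M\<^esub> y \<oplus>\<^bsub>M\<^esub> _\<close>
          by (simp add: a_minus_def M.a_comm[of _ "v \<oplus>\<^bsub>M\<^esub> \<ominus>\<^bsub>M\<^esub> (a \<odot>\<^bsub>M\<^esub> w)"] M.a_assoc M.r_neg)
        ultimately show ?thesis by simp
      qed
      moreover have "v \<ominus>\<^bsub>M\<^esub> a \<odot>\<^bsub>M\<^esub> w \<in> module_span R M B" using spm(4) a(2) aw by blast
      ultimately show ?thesis using m[OF k] ay Sm(3) by blast
    qed
    then have "\<forall>k\<ge>m. S k = S m" using antimonoD[OF insert.prems(3)] by blast
    then show ?thesis by blast
  qed
qed

end

context fin_dim_algebra
begin

lemma left_module_scalars: "left_module K A"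
  by unfold_locales
    (auto simp: smult_l_distr smult_r_distr smult_assoc1)

text \<open>
  Both chains \<open>A x\<^sup>k\<close> and \<open>x\<^sup>k A\<close> become constant, so \<open>x\<^sup>m = b x\<^sup>2\<^sup>m = x\<^sup>2\<^sup>m a\<close> for a large \<open>m\<close>.  Then
  \<open>b x\<^sup>m = b x\<^sup>2\<^sup>m a = x\<^sup>m a\<close>, and this element \<open>g\<close> satisfies \<open>g g = b x\<^sup>m x\<^sup>m a = x\<^sup>m a = g\<close>.
\<close>

lemma idempotent_of_power:
  assumes x: "x \<in> carrier A"
  shows "\<exists>m\<ge>1. \<exists>b\<in>carrier A. idempotent_elem A (b \<otimes>\<^bsub>A\<^esub> x [^]\<^bsub>A\<^esub> m)
    \<and> b \<otimes>\<^bsub>A\<^esub> x [^]\<^bsub>A\<^esub> m \<otimes>\<^bsub>A\<^esub> x [^]\<^bsub>A\<^esub> m = x [^]\<^bsub>A\<^esub> (m::nat)"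
proof -
  interpret V: left_module K A by (rule left_module_scalars)
  obtain B where B: "finite B" "B \<subseteq> carrier A" "module_span K A B = carrier A"
    using fin_dim by blast
  let ?p = "\<lambda>k::nat. x [^]\<^bsub>A\<^esub> k"
  define S where "S = (\<lambda>k. (\<lambda>y. y \<otimes>\<^bsub>A\<^esub> ?p k) ` carrier A)"
  define T where "T = (\<lambda>k. (\<lambda>y. ?p k \<otimes>\<^bsub>A\<^esub> y) ` carrier A)"
  have pow: "?p (k + l) = ?p k \<otimes>\<^bsub>A\<^esub> ?p l" for k l using x by (simp add: A.nat_pow_mult)
  have p: "?p k \<in> carrier A" for k using x by simp
  have "\<exists>m. \<forall>k\<ge>m. S k = S m"
  proof (rule V.subspace_chain_stabilises[OF K.field_axioms B(1,2)])
    show "submodule (S m) K A" for m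
    proof (rule V.submoduleI)
      show "S m \<subseteq> carrier A" using p by (auto simp: S_def)
      show "\<zero>\<^bsub>A\<^esub> \<in> S m" using p by (auto simp: S_def intro!: image_eqI[of _ _ "\<zero>\<^bsub>A\<^esub>"])
      show "u \<oplus>\<^bsub>A\<^esub> v \<in> S m" if "u \<in> S m" "v \<in> S m" for u v
        using that p by (auto simp: S_def simp flip: A.l_distr)
      show "r \<odot>\<^bsub>A\<^esub> v \<in> S m" if "r \<in> carrier K" "v \<in> S m" for r v
        using that p by (auto simp: S_def simp flip: smult_mult_left)
    qed
    show "S m \<subseteq> module_span K A B" for m using p by (auto simp: S_def B(3))
    show "antimono S"
    proof (unfold antimono_iff_le_Suc, rule)
      fix k
      have "y \<otimes>\<^bsub>A\<^esub> ?p (Suc k) = (y \<otimes>\<^bsub>A\<^esub> x) \<otimes>\<^bsub>A\<^esub> ?p k" if "y \<in> carrier A" for y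
        using that x pow[of 1 k] by (simp add: A.m_assoc)
      then show "S (Suc k) \<subseteq> S k" using x by (auto simp: S_def)
    qed
  qed
  then obtain m1 where m1: "\<And>k. k \<ge> m1 \<Longrightarrow> S k = S m1" by blast
  have "\<exists>m. \<forall>k\<ge>m. T k = T m"
  proof (rule V.subspace_chain_stabilises[OF K.field_axioms B(1,2)])
    show "submodule (T m) K A" for m
    proof (rule V.submoduleI)
      show "T m \<subseteq> carrier A" using p by (auto simp: T_def)
      show "\<zero>\<^bsub>A\<^esub> \<in> T m" using p by (auto simp: T_def intro!: image_eqI[of _ _ "\<zero>\<^bsub>A\<^esub>"])
      show "u \<oplus>\<^bsub>A\<^esub> v \<in> T m" if "u \<in> T m" "v \<in> T m" for u v
        using that p by (auto simp: T_def simp flip: A.r_distr)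
      show "r \<odot>\<^bsub>A\<^esub> v \<in> T m" if "r \<in> carrier K" "v \<in> T m" for r v
        using that p by (auto simp: T_def simp flip: smult_mult_right)
    qed
    show "T m \<subseteq> module_span K A B" for m using p by (auto simp: T_def B(3))
    show "antimono T"
    proof (unfold antimono_iff_le_Suc, rule)
      fix k
      have "?p (Suc k) \<otimes>\<^bsub>A\<^esub> y = ?p k \<otimes>\<^bsub>A\<^esub> (x \<otimes>\<^bsub>A\<^esub> y)" if "y \<in> carrier A" for y
        using that x by (simp add: A.m_assoc)
      then show "T (Suc k) \<subseteq> T k" using x by (auto simp: T_def)
    qed
  qed
  then obtain m2 where m2: "\<And>k. k \<ge> m2 \<Longrightarrow> T k = T m2" by blast
  \<comment> \<open>Beyond both stabilisation points; the successor makes the exponent positive.\<close>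
  define m where "m = Suc (m1 + m2)"
  have "?p m = \<one>\<^bsub>A\<^esub> \<otimes>\<^bsub>A\<^esub> ?p m" using p by simp
  then have "?p m \<in> S m" unfolding S_def by blast
  also have "S m = S (m + m)" using m1[of m] m1[of "m + m"] by (simp add: m_def)
  finally obtain b where b: "b \<in> carrier A" "?p m = b \<otimes>\<^bsub>A\<^esub> (?p m \<otimes>\<^bsub>A\<^esub> ?p m)"
    by (auto simp: S_def pow)
  have "?p m = ?p m \<otimes>\<^bsub>A\<^esub> \<one>\<^bsub>A\<^esub>" using p by simp
  then have "?p m \<in> T m" unfolding T_def by blast
  also have "T m = T (m + m)" using m2[of m] m2[of "m + m"] by (simp add: m_def)
  finally obtain a where a: "a \<in> carrier A" "?p m = (?p m \<otimes>\<^bsub>A\<^esub> ?p m) \<otimes>\<^bsub>A\<^esub> a"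
    by (auto simp: T_def pow)
  let ?g = "b \<otimes>\<^bsub>A\<^esub> ?p m"
  have gx: "?g \<otimes>\<^bsub>A\<^esub> ?p m = ?p m" using b p[of m] by (simp add: A.m_assoc)
  have "?g = b \<otimes>\<^bsub>A\<^esub> ((?p m \<otimes>\<^bsub>A\<^esub> ?p m) \<otimes>\<^bsub>A\<^esub> a)" using a(2) by simp
  also have "\<dots> = (b \<otimes>\<^bsub>A\<^esub> (?p m \<otimes>\<^bsub>A\<^esub> ?p m)) \<otimes>\<^bsub>A\<^esub> a" using a(1) b(1) p[of m] by (simp add: A.m_assoc)
  also have "\<dots> = ?p m \<otimes>\<^bsub>A\<^esub> a" using b(2) by simp
  finally have g: "?g = ?p m \<otimes>\<^bsub>A\<^esub> a" .
  have "?g \<otimes>\<^bsub>A\<^esub> ?g = ?g \<otimes>\<^bsub>A\<^esub> (?p m \<otimes>\<^bsub>A\<^esub> a)" by (subst (2) g) simp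
  also have "\<dots> = (?g \<otimes>\<^bsub>A\<^esub> ?p m) \<otimes>\<^bsub>A\<^esub> a" using a(1) b(1) p[of m] by (simp add: A.m_assoc)
  also have "\<dots> = ?g" using gx g by simp
  finally have "idempotent_elem A ?g" using b p by (simp add: idempotent_elem_def)
  then show ?thesis using gx b(1) by (intro exI[of _ m]) (auto simp: m_def)
qed

end

section \<open>Basic algebras: the off-diagonal corners lie in the radical\<close>

text \<open>Otherwise \<open>e = f + (e - f)\<close> would split \<open>e\<close> into nonzero orthogonal idempotents.\<close>

lemma (in ring) primitive_absorbs:
  assumes e: "primitive_idempotent R e" and f: "idempotent_elem R f" "f \<noteq> \<zero>"
    and ef: "e \<otimes> f = f" "f \<otimes> e = f"
  shows "f = e"
proof -
  have c: "e \<in> carrier R" "f \<in> carrier R" "e \<otimes> e = e" "f \<otimes> f = f"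
    using e f by (auto simp: primitive_idempotent_def idempotent_elem_def)
  have d: "(e \<ominus> f) \<otimes> f = \<zero>" "f \<otimes> (e \<ominus> f) = \<zero>"
    using c ef by (simp_all add: a_minus_def l_distr r_distr l_minus r_minus r_neg)
  have "(e \<ominus> f) \<otimes> (e \<ominus> f) = (e \<ominus> f) \<otimes> e \<ominus> (e \<ominus> f) \<otimes> f"
    using c by (simp add: a_minus_def r_distr r_minus)
  also have "\<dots> = e \<ominus> f"
    using c d ef by (simp add: a_minus_def l_distr l_minus)
  finally have "idempotent_elem R (e \<ominus> f)" using c by (simp add: idempotent_elem_def)
  moreover have ee: "e = f \<oplus> (e \<ominus> f)"
    using c by (simp add: a_minus_def a_lcomm r_neg)
  ultimately have "e \<ominus> f = \<zero>"
    using e f d unfolding primitive_idempotent_def by metis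
  then show ?thesis using ee c by simp
qed

text \<open>Right multiplication by \<open>a\<close> is the isomorphism, right multiplication by \<open>z\<close> its inverse.\<close>

lemma (in ring) principal_module_iso:
  assumes c: "e \<in> carrier R" "f \<in> carrier R" "a \<in> carrier R" "z \<in> carrier R"
    and a: "e \<otimes> a = a" "a \<otimes> f = a" and z: "f \<otimes> z = z" "z \<otimes> e = z"
    and az: "a \<otimes> z = e" "z \<otimes> a = f"
  shows "left_module_isomorphic R (principal_module R e) (principal_module R f)"
proof -
  have car: "carrier (principal_module R e) = (\<lambda>x. x \<otimes> e) ` carrier R" for e
    by (simp add: principal_module_def)
  have "bij_betw (\<lambda>y. y \<otimes> a) (carrier (principal_module R e)) (carrier (principal_module R f))"
  proof (rule bij_betw_byWitness[where f' = "\<lambda>y. y \<otimes> z"])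
    have "x \<otimes> a = (x \<otimes> a) \<otimes> f" "x \<otimes> z = (x \<otimes> z) \<otimes> e" if "x \<in> carrier R" for x
      using that a z c by (simp_all add: m_assoc)
    with c show "(\<lambda>y. y \<otimes> a) ` carrier (principal_module R e) \<subseteq> carrier (principal_module R f)"
      "(\<lambda>y. y \<otimes> z) ` carrier (principal_module R f) \<subseteq> carrier (principal_module R e)"
      unfolding car by (blast intro: m_closed)+
    have ee: "e \<otimes> e = e" "f \<otimes> f = f"
      using az a z c by (metis m_assoc)+
    show "\<forall>y\<in>carrier (principal_module R e). y \<otimes> a \<otimes> z = y"
      "\<forall>y\<in>carrier (principal_module R f). y \<otimes> z \<otimes> a = y"
      using c az ee by (auto simp: car m_assoc)
  qed
  then have "(\<lambda>y. y \<otimes> a) \<in> left_module_iso_maps R (principal_module R e) (principal_module R f)"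
    using c by (auto simp: left_module_iso_maps_def car)
       (auto simp: principal_module_def regular_module_def l_distr m_assoc)
  then show ?thesis by (auto simp: left_module_isomorphic_def)
qed

text \<open>
  An element outside the radical is a unit modulo a maximal left ideal, so some left multiple of
  it is congruent to \<open>1\<close> there; powers of that multiple are congruent to \<open>1\<close> as well and hence
  nonzero.
\<close>

lemma (in ring) nonradical_multiple_not_nilpotent:
  assumes a: "a \<in> carrier R" "a \<notin> jacobson_radical R"
  shows "\<exists>b\<in>carrier R. \<forall>k::nat. (b \<otimes> a) [^] k \<noteq> \<zero>"
proof -
  interpret L: left_module R "regular_module R" by (rule left_module_regular)
  have reg: "carrier (regular_module R) = carrier R" "add (regular_module R) = add R"
    "zero (regular_module R) = \<zero>" "smult (regular_module R) = mult R"
    by (simp_all add: regular_module_def)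
  obtain I where I: "maximal_left_ideal I R" "a \<notin> I"
    using a by (auto simp: jacobson_radical_def)
  have sI: "submodule I R (regular_module R)" using I(1) by (simp add: maximal_left_ideal_def)
  note Im = L.submodule_mem[OF sI, unfolded reg]
  have Ic: "x \<in> carrier R" if "x \<in> I" for x using Im(1) that by blast
  let ?S = "{y \<otimes> a \<oplus> x | y x. y \<in> carrier R \<and> x \<in> I}"
  have "submodule ?S R (regular_module R)"
  proof (rule L.submoduleI, unfold reg)
    show "\<zero> \<in> ?S" using a Im(2) by (intro CollectI exI[of _ \<zero>]) auto
    fix u v assume "u \<in> ?S" "v \<in> ?S"
    then obtain y x y' x' where *: "y \<in> carrier R" "x \<in> I" "y' \<in> carrier R" "x' \<in> I"
      "u = y \<otimes> a \<oplus> x" "v = y' \<otimes> a \<oplus> x'" by blast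
    then have "u \<oplus> v = (y \<oplus> y') \<otimes> a \<oplus> (x \<oplus> x')"
      using a(1) Ic by (simp add: l_distr a_ac)
    then show "u \<oplus> v \<in> ?S" using * Im(3) by blast
  next
    fix r u assume r: "r \<in> carrier R" and "u \<in> ?S"
    then obtain y x where *: "y \<in> carrier R" "x \<in> I" "u = y \<otimes> a \<oplus> x" by blast
    then have "r \<otimes> u = (r \<otimes> y) \<otimes> a \<oplus> r \<otimes> x"
      using a(1) Ic r by (simp add: r_distr m_assoc)
    then show "r \<otimes> u \<in> ?S" using * Im(5) r by blast
  qed (use a Ic in auto)
  moreover have "I \<subseteq> ?S"
  proof
    fix x assume "x \<in> I"
    then show "x \<in> ?S" using a Ic by (intro CollectI exI[of _ \<zero>] exI[of _ x]) auto
  qed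
  moreover have "a \<in> ?S" using a Im(2) by (intro CollectI exI[of _ \<one>] exI[of _ \<zero>]) auto
  ultimately have "?S = carrier R"
    using I unfolding maximal_left_ideal_def by blast
  then obtain b m where b: "b \<in> carrier R" "m \<in> I" "\<one> = b \<otimes> a \<oplus> m"
    using one_closed by blast
  have x: "b \<otimes> a \<in> carrier R" using a b by simp
  \<comment> \<open>The congruence holds modulo a left ideal only: \<open>x\<^sup>k\<^sup>+\<^sup>1 - 1 = x (x\<^sup>k - 1) + (x - 1)\<close>.\<close>
  have cong: "(b \<otimes> a) [^] k \<ominus> \<one> \<in> I" for k :: nat
  proof (induction k)
    case 0
    then show ?case using Im(2) by (simp add: a_minus_def r_neg)
  next
    case (Suc k)
    let ?x = "b \<otimes> a"
    have "?x \<ominus> \<one> = \<zero> \<ominus> m"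
      using b x Ic by (simp add: a_minus_def minus_add r_neg flip: a_assoc)
    moreover have "\<zero> \<ominus> m = \<ominus> \<one> \<otimes> m" using Ic[OF b(2)] by (simp add: a_minus_def l_minus)
    ultimately have "?x \<ominus> \<one> \<in> I" using Im(5)[of "\<ominus> \<one>" m] b(2) by simp
    then have "?x \<otimes> (?x [^] k \<ominus> \<one>) \<oplus> (?x \<ominus> \<one>) \<in> I" using Im(3,5) Suc x by blast
    moreover have "?x \<otimes> (?x [^] k \<ominus> \<one>) \<oplus> (?x \<ominus> \<one>) = ?x [^] Suc k \<ominus> \<one>"
    proof -
      have "?x \<otimes> (?x [^] k \<ominus> \<one>) = ?x [^] Suc k \<ominus> ?x"
        using x by (simp add: a_minus_def r_distr r_minus flip: nat_pow_Suc2)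
      then show ?thesis using x by (simp add: a_minus_def a_assoc r_neg1 r_neg2)
    qed
    ultimately show ?case by simp
  qed
  have "(b \<otimes> a) [^] k \<noteq> \<zero>" for k :: nat
  proof
    assume "(b \<otimes> a) [^] k = \<zero>"
    then have "\<ominus> \<one> \<in> I" using cong[of k] by (simp add: a_minus_def)
    then have "\<one> \<in> I" using Im(5)[of "\<ominus> \<one>" "\<ominus> \<one>"] by (simp add: l_minus)
    then have "carrier R \<subseteq> I" using Im(5)[of _ \<one>] by auto
    then show False using I(1) Im(1) by (auto simp: maximal_left_ideal_def)
  qed
  then show ?thesis using b(1) by blast
qed

text \<open>
  An element \<open>a\<close> of \<open>e A f\<close> outside the radical has a non-nilpotent left multiple \<open>x = b a = x f\<close>,
  and some \<open>b' x\<^sup>m\<close> is a nonzero idempotent.  By primitivity of \<open>f\<close> it yields a left inverse \<open>z\<close> of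
  \<open>a\<close>, that is \<open>z a = f\<close>; then \<open>a z\<close> is a nonzero idempotent of \<open>e A e\<close>, so \<open>a z = e\<close> and right
  multiplication by \<open>a\<close> is an isomorphism \<open>A e \<cong> A f\<close>.
\<close>

lemma (in fin_dim_algebra) nonradical_corner_iso:
  assumes e: "primitive_idempotent A e" and f: "primitive_idempotent A f"
    and a: "a \<in> carrier A" "e \<otimes>\<^bsub>A\<^esub> a = a" "a \<otimes>\<^bsub>A\<^esub> f = a" "a \<notin> jacobson_radical A"
  shows "left_module_isomorphic A (principal_module A e) (principal_module A f)"
proof -
  have c: "e \<in> carrier A" "f \<in> carrier A" "e \<otimes>\<^bsub>A\<^esub> e = e" "f \<otimes>\<^bsub>A\<^esub> f = f" "f \<noteq> \<zero>\<^bsub>A\<^esub>"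
    using e f by (auto simp: primitive_idempotent_def idempotent_elem_def)
  obtain b where b: "b \<in> carrier A" "\<And>k::nat. (b \<otimes>\<^bsub>A\<^esub> a) [^]\<^bsub>A\<^esub> k \<noteq> \<zero>\<^bsub>A\<^esub>"
    using A.nonradical_multiple_not_nilpotent[OF a(1,4)] by blast
  define x where "x = b \<otimes>\<^bsub>A\<^esub> a"
  have x: "x \<in> carrier A" "x \<otimes>\<^bsub>A\<^esub> f = x" using a b c by (simp_all add: x_def A.m_assoc)
  obtain m b' where m: "m \<ge> (1::nat)" "b' \<in> carrier A" "idempotent_elem A (b' \<otimes>\<^bsub>A\<^esub> x [^]\<^bsub>A\<^esub> m)"
    "b' \<otimes>\<^bsub>A\<^esub> x [^]\<^bsub>A\<^esub> m \<otimes>\<^bsub>A\<^esub> x [^]\<^bsub>A\<^esub> m = x [^]\<^bsub>A\<^esub> m"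
    using idempotent_of_power[OF x(1)] by blast
  define g where "g = b' \<otimes>\<^bsub>A\<^esub> x [^]\<^bsub>A\<^esub> m"
  obtain k where k: "m = Suc k" using m(1) by (cases m) auto
  have g: "g \<in> carrier A" "g \<otimes>\<^bsub>A\<^esub> g = g" using m by (auto simp: g_def idempotent_elem_def)
  have gf: "g \<otimes>\<^bsub>A\<^esub> f = g" using m x c by (simp add: g_def k A.m_assoc)
  have g0: "g \<noteq> \<zero>\<^bsub>A\<^esub>" using m(4) b(2)[of m] x(1) by (auto simp: g_def[symmetric] x_def[symmetric])
  \<comment> \<open>The idempotent \<open>g = g f\<close> need not lie in \<open>f A f\<close>, but \<open>f g\<close> does.\<close>
  have ff: "f \<otimes>\<^bsub>A\<^esub> g = f"
  proof (rule A.primitive_absorbs[OF f])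
    have "g \<otimes>\<^bsub>A\<^esub> (f \<otimes>\<^bsub>A\<^esub> g) = g" using g gf c by (simp flip: A.m_assoc)
    then show "f \<otimes>\<^bsub>A\<^esub> g \<noteq> \<zero>\<^bsub>A\<^esub>" using g0 g(1) by auto
    have "(f \<otimes>\<^bsub>A\<^esub> g) \<otimes>\<^bsub>A\<^esub> (f \<otimes>\<^bsub>A\<^esub> g) = f \<otimes>\<^bsub>A\<^esub> (g \<otimes>\<^bsub>A\<^esub> (f \<otimes>\<^bsub>A\<^esub> g))" using g c by (simp add: A.m_assoc)
    then show "idempotent_elem A (f \<otimes>\<^bsub>A\<^esub> g)"
      using g c \<open>g \<otimes>\<^bsub>A\<^esub> (f \<otimes>\<^bsub>A\<^esub> g) = g\<close> by (simp add: idempotent_elem_def)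
    show "f \<otimes>\<^bsub>A\<^esub> (f \<otimes>\<^bsub>A\<^esub> g) = f \<otimes>\<^bsub>A\<^esub> g" using g c by (simp flip: A.m_assoc)
    show "f \<otimes>\<^bsub>A\<^esub> g \<otimes>\<^bsub>A\<^esub> f = f \<otimes>\<^bsub>A\<^esub> g" using g gf c by (simp add: A.m_assoc)
  qed
  define z where "z = f \<otimes>\<^bsub>A\<^esub> (b' \<otimes>\<^bsub>A\<^esub> (x [^]\<^bsub>A\<^esub> k \<otimes>\<^bsub>A\<^esub> (b \<otimes>\<^bsub>A\<^esub> e)))"
  have z: "z \<in> carrier A" "f \<otimes>\<^bsub>A\<^esub> z = z" "z \<otimes>\<^bsub>A\<^esub> e = z"
    using c m b x by (simp_all add: z_def A.m_assoc) (simp flip: A.m_assoc add: c)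
  have "z \<otimes>\<^bsub>A\<^esub> a = f \<otimes>\<^bsub>A\<^esub> (b' \<otimes>\<^bsub>A\<^esub> (x [^]\<^bsub>A\<^esub> k \<otimes>\<^bsub>A\<^esub> x))"
    using c m b x a by (simp add: z_def A.m_assoc x_def)
  then have za: "z \<otimes>\<^bsub>A\<^esub> a = f" using ff by (simp add: g_def k)
  have aza: "(a \<otimes>\<^bsub>A\<^esub> z) \<otimes>\<^bsub>A\<^esub> a = a" using za a z c by (simp add: A.m_assoc)
  have "a \<otimes>\<^bsub>A\<^esub> z = e"
  proof (rule A.primitive_absorbs[OF e])
    have "(a \<otimes>\<^bsub>A\<^esub> z) \<otimes>\<^bsub>A\<^esub> (a \<otimes>\<^bsub>A\<^esub> z) = a \<otimes>\<^bsub>A\<^esub> z" using aza a z by (simp flip: A.m_assoc)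
    then show "idempotent_elem A (a \<otimes>\<^bsub>A\<^esub> z)" using a z by (simp add: idempotent_elem_def)
    show "a \<otimes>\<^bsub>A\<^esub> z \<noteq> \<zero>\<^bsub>A\<^esub>" using aza za a z c by auto
    show "e \<otimes>\<^bsub>A\<^esub> (a \<otimes>\<^bsub>A\<^esub> z) = a \<otimes>\<^bsub>A\<^esub> z" using a z c by (simp flip: A.m_assoc)
    show "a \<otimes>\<^bsub>A\<^esub> z \<otimes>\<^bsub>A\<^esub> e = a \<otimes>\<^bsub>A\<^esub> z" using a z c by (simp add: A.m_assoc)
  qed
  then show ?thesis by (intro A.principal_module_iso[of e f a z] c a z za)
qed

lemma (in fin_dim_algebra) basic_corner_radical:
  assumes "complete_primitive_idempotents A t e" "basic_wrt A t e"
    and h: "h \<in> {1..t}" "l \<in> {1..t}" "h \<noteq> l" and a: "a \<in> carrier A"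
  shows "e h \<otimes>\<^bsub>A\<^esub> a \<otimes>\<^bsub>A\<^esub> e l \<in> jacobson_radical A"
proof (rule ccontr)
  assume *: "e h \<otimes>\<^bsub>A\<^esub> a \<otimes>\<^bsub>A\<^esub> e l \<notin> jacobson_radical A"
  have p: "primitive_idempotent A (e h)" "primitive_idempotent A (e l)"
    using assms by (auto simp: complete_primitive_idempotents_def)
  then have c: "e h \<in> carrier A" "e l \<in> carrier A" "e h \<otimes>\<^bsub>A\<^esub> e h = e h" "e l \<otimes>\<^bsub>A\<^esub> e l = e l"
    by (auto simp: primitive_idempotent_def idempotent_elem_def)
  have "left_module_isomorphic A (principal_module A (e h)) (principal_module A (e l))"
    by (rule nonradical_corner_iso[OF p _ _ _ *])
       (use c a in \<open>simp_all add: A.m_assoc\<close>, simp flip: A.m_assoc)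
  then show False using assms by (auto simp: basic_wrt_def)
qed

section \<open>Submodules of the last radical layer\<close>

text \<open>
  The condition \<open>e\<^sub>h R e\<^sub>l \<subseteq> J\<close> for \<open>h \<noteq> l\<close> is the form in which basicness and finite dimension
  enter; for a basic finite-dimensional algebra it is \<open>basic_corner_radical\<close>.
\<close>

locale idempotent_decomposition = ring R for R :: "('a, 'm) ring_scheme" (structure) +
  fixes t n :: nat and e :: "nat \<Rightarrow> 'a" and i j :: nat
  assumes complete: "complete_primitive_idempotents R t e"
    and i: "i \<in> {1..t}" and j: "j \<in> {1..t}"
    and n: "n \<ge> 1" and nilpotent: "ideal_power R (jacobson_radical R) n = {\<zero>}"
    and off_diagonal: "\<And>h l a. \<lbrakk>h \<in> {1..t}; l \<in> {1..t}; h \<noteq> l; a \<in> carrier R\<rbrakk>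
      \<Longrightarrow> e h \<otimes> a \<otimes> e l \<in> jacobson_radical R"
begin

abbreviation "top_layer \<equiv> radical_submodule R (principal_module R (e i)) (n - 1)"

lemma e_closed [simp]: "h \<in> {1..t} \<Longrightarrow> e h \<in> carrier R"
  and e_idem: "h \<in> {1..t} \<Longrightarrow> e h \<otimes> e h = e h"
  and e_orth: "h \<in> {1..t} \<Longrightarrow> l \<in> {1..t} \<Longrightarrow> h \<noteq> l \<Longrightarrow> e h \<otimes> e l = \<zero>"
  and e_sum: "finsum R e {1..t} = \<one>"
  using complete
  by (auto simp: complete_primitive_idempotents_def primitive_idempotent_def idempotent_elem_def)

lemma left_module_P: "left_module R (principal_module R (e i))"
  by (intro principal_left_module e_closed i)

lemma principal_simps:
  "carrier (principal_module R (e i)) = (\<lambda>x. x \<otimes> e i) ` carrier R"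
  "add (principal_module R (e i)) = add R" "zero (principal_module R (e i)) = \<zero>"
  "smult (principal_module R (e i)) = mult R"
  by (simp_all add: principal_module_def regular_module_def)

lemma top_layer_submodule: "submodule top_layer R (principal_module R (e i))"
  by (rule left_module.radical_submodule_submodule[OF left_module_P])

lemmas top_layer_mem = left_module.submodule_mem[OF left_module_P top_layer_submodule, unfolded principal_simps]

lemma top_layer_closed [simp]: "x \<in> top_layer \<Longrightarrow> x \<in> carrier R"
  using top_layer_mem(1) i by auto

lemma radical_kills_top_layer:
  assumes a: "a \<in> jacobson_radical R" and x: "x \<in> top_layer"
  shows "a \<otimes> x = \<zero>"
proof -
  have ac: "a \<in> carrier R" using a by (simp add: jacobson_radical_def)
  interpret G: left_module R "regular_module R" by (rule left_module_regular)
  have pc: "b \<in> carrier R" if "b \<in> ideal_power R (jacobson_radical R) (n - 1)" for b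
    using G.submodule_mem(1)[OF ideal_power_left_ideal[OF jacobson_radical_left_ideal]] that
    by (auto simp: regular_module_def)
  have ab: "a \<otimes> b = \<zero>" if "b \<in> ideal_power R (jacobson_radical R) (n - 1)" for b
  proof -
    have "a \<otimes> b \<in> ideal_power R (jacobson_radical R) (Suc (n - 1))"
      using a that by (auto intro: ideal_prod.prod)
    then show ?thesis using nilpotent n by simp
  qed
  have "x \<in> carrier R \<and> a \<otimes> x = \<zero>"
    using x unfolding radical_submodule_def
  proof induction
    case zero
    then show ?case using ac by (simp add: principal_simps)
  next
    case (smult b y)
    then have y: "y \<in> carrier R" using i by (auto simp: principal_simps)
    have "a \<otimes> (b \<otimes> y) = (a \<otimes> b) \<otimes> y" using ac y pc smult by (simp add: m_assoc)
    then show ?case using ab smult y pc by (simp add: principal_simps)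
  next
    case (sum x y)
    then show ?case using ac by (simp add: principal_simps r_distr)
  qed
  then show ?thesis by simp
qed

lemma corner_subset_top_layer: "corner R (e j) (ideal_power R (jacobson_radical R) (n - 1)) (e i) \<subseteq> top_layer"
proof
  interpret G: left_module R "regular_module R" by (rule left_module_regular)
  fix x assume "x \<in> corner R (e j) (ideal_power R (jacobson_radical R) (n - 1)) (e i)"
  then obtain y where y: "y \<in> ideal_power R (jacobson_radical R) (n - 1)" "x = e j \<otimes> y \<otimes> e i"
    by (auto simp: corner_def)
  have yc: "y \<in> carrier R"
    using G.submodule_mem(1)[OF ideal_power_left_ideal[OF jacobson_radical_left_ideal]] y
    by (auto simp: regular_module_def)
  have "e i \<in> carrier (principal_module R (e i))"
    unfolding principal_simps by (rule image_eqI[of _ _ \<one>]) (use i in auto)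
  then have "y \<odot>\<^bsub>principal_module R (e i)\<^esub> e i \<in> top_layer"
    unfolding radical_submodule_def by (intro ideal_smult.smult y)
  then have "e j \<otimes> (y \<otimes> e i) \<in> top_layer" using top_layer_mem(5) j by (simp add: principal_simps)
  then show "x \<in> top_layer" using y yc i j by (simp add: m_assoc)
qed

text \<open>
  Expanding \<open>e\<^sub>j r = \<Sum>\<^sub>l e\<^sub>j r e\<^sub>l\<close>, the terms with \<open>l \<noteq> j\<close> lie in \<open>J\<close> and annihilate the top layer
  \<open>J\<^sup>n\<^sup>-\<^sup>1 P\<^sub>i\<close>.  So on the \<open>e\<^sub>j\<close>-components of the top layer, \<open>r\<close> acts through \<open>e\<^sub>j r e\<^sub>j\<close> alone.
\<close>

lemma diagonal_action_on_top_layer: "e j \<otimes> (r \<otimes> x) = e j \<otimes> r \<otimes> e j \<otimes> (e j \<otimes> x)"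
  if r: "r \<in> carrier R" and x: "x \<in> top_layer"
proof -
  have xc: "x \<in> carrier R" using x by simp
  have "e j \<otimes> r = (\<Oplus>l\<in>{1..t}. e j \<otimes> r \<otimes> e l)"
    using finsum_rdistr[of "{1..t}" "e j \<otimes> r" e] r j e_sum by simp
  then have "e j \<otimes> r \<otimes> x = (\<Oplus>l\<in>{1..t}. e j \<otimes> r \<otimes> e l \<otimes> x)"
    using finsum_ldistr[of "{1..t}" x "\<lambda>l. e j \<otimes> r \<otimes> e l"] r j xc by simp
  also have "\<dots> = (\<Oplus>l\<in>{1..t}. if j = l then e j \<otimes> r \<otimes> e l \<otimes> x else \<zero>)"
    using r j xc by (intro finsum_cong') (auto intro: radical_kills_top_layer[OF off_diagonal x])
  also have "\<dots> = e j \<otimes> r \<otimes> e j \<otimes> x"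
    using finsum_singleton[OF j, of "\<lambda>l. e j \<otimes> r \<otimes> e l \<otimes> x"] r j xc by auto
  also have "\<dots> = e j \<otimes> r \<otimes> (e j \<otimes> e j) \<otimes> x" using e_idem[OF j] by simp
  also have "\<dots> = e j \<otimes> r \<otimes> e j \<otimes> (e j \<otimes> x)" using r j xc by (simp add: m_assoc)
  finally show ?thesis using r j xc by (simp add: m_assoc)
qed

lemma top_component_subset: "h \<in> {1..t} \<Longrightarrow> top_component R n e i h \<subseteq> top_layer"
  using top_layer_mem(5) by (auto simp: top_component_def)

lemma top_component_fixed:
  assumes "h \<in> {1..t}" "l \<in> {1..t}" "x \<in> top_component R n e i h"
  shows "e l \<otimes> x = (if h = l then x else \<zero>)"
  using assms by (auto simp: top_component_def e_idem e_orth simp flip: m_assoc)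

lemma e_mult_sum:
  assumes H: "H \<subseteq> {1..t}" and l: "l \<in> {1..t}" and x: "x \<in> Pi H (top_component R n e i)"
  shows "e l \<otimes> finsum R x H = (if l \<in> H then x l else \<zero>)"
proof -
  have fin: "finite H" using H finite_subset by blast
  have xc: "x h \<in> carrier R" if "h \<in> H" for h
    using that x H top_component_subset[of h] by (intro top_layer_closed) blast
  have "e l \<otimes> finsum R x H = (\<Oplus>h\<in>H. e l \<otimes> x h)"
    by (rule finsum_rdistr) (use fin l xc in auto)
  also have "\<dots> = (\<Oplus>h\<in>H. if l = h then x h else \<zero>)"
    using top_component_fixed[OF _ l] x H xc by (intro finsum_cong') (auto simp: Pi_def)
  also have "\<dots> = (if l \<in> H then x l else \<zero>)"
  proof (cases "l \<in> H")
    case True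
    then show ?thesis using finsum_singleton[OF True fin, of x] xc by auto
  next
    case False
    then have "(\<Oplus>h\<in>H. if l = h then x h else \<zero>) = (\<Oplus>h\<in>H. \<zero>)"
      by (intro finsum_cong') auto
    then show ?thesis using False by simp
  qed
  finally show ?thesis .
qed

lemma top_components_direct: "sum_is_direct R ({1..t} - {j}) (top_component R n e i)"
  unfolding sum_is_direct_def
proof (intro ballI impI)
  fix x h assume x: "x \<in> Pi ({1..t} - {j}) (top_component R n e i)"
    and "finsum R x ({1..t} - {j}) = \<zero>" "h \<in> {1..t} - {j}"
  then show "x h = \<zero>" using e_mult_sum[OF _ _ x, of h] by auto
qed

lemma W_sub_subset: "W_sub R n t e i j \<subseteq> top_layer"
proof
  fix w assume "w \<in> W_sub R n t e i j"
  then obtain x where x: "x \<in> Pi ({1..t} - {j}) (top_component R n e i)"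
    "w = finsum R x ({1..t} - {j})"
    by (auto simp: W_sub_def sum_of_family_def)
  have xL: "x h \<in> top_layer" if "h \<in> {1..t} - {j}" for h using that x top_component_subset[of h] by auto
  have "finsum R x H \<in> top_layer" if "finite H" "H \<subseteq> {1..t} - {j}" for H
    using that
  proof (induction H rule: finite_induct)
    case empty
    then show ?case using top_layer_mem(2) by simp
  next
    case (insert h H)
    then have "x h \<in> top_layer" "\<And>k. k \<in> H \<Longrightarrow> x k \<in> top_layer" using xL by blast+
    moreover have "finsum R x (insert h H) = x h \<oplus> finsum R x H"
      using insert calculation by (intro finsum_insert) auto
    ultimately show ?case using top_layer_mem(3) insert by auto
  qed
  then show "w \<in> top_layer" using x by simp
qed

lemma W_sub_kill:
  assumes "w \<in> W_sub R n t e i j"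
  shows "e j \<otimes> w = \<zero>"
proof -
  obtain x where x: "x \<in> Pi ({1..t} - {j}) (top_component R n e i)"
    "w = finsum R x ({1..t} - {j})"
    using assms by (auto simp: W_sub_def sum_of_family_def)
  show ?thesis using e_mult_sum[OF _ j x(1)] x(2) by auto
qed

text \<open>
  Membership in \<open>W\<^sub>j + U\<close> is a condition on the \<open>e\<^sub>j\<close>-component only; in this form closure under
  scalars follows from \<open>diagonal_action_on_top_layer\<close>.
\<close>

lemma K_sub_conv:
  assumes U: "U \<subseteq> top_layer" "\<And>u. u \<in> U \<Longrightarrow> e j \<otimes> u = u"
  shows "K_sub R n t e i j U = {k \<in> top_layer. e j \<otimes> k \<in> U}"
proof
  show "K_sub R n t e i j U \<subseteq> {k \<in> top_layer. e j \<otimes> k \<in> U}"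
  proof
    fix k assume "k \<in> K_sub R n t e i j U"
    then obtain w u where wu: "w \<in> W_sub R n t e i j" "u \<in> U" "k = w \<oplus> u"
      by (auto simp: K_sub_def set_add_def')
    then have wu_top: "w \<in> top_layer" "u \<in> top_layer" using W_sub_subset U by auto
    then have "e j \<otimes> k = u" using wu j W_sub_kill U(2) by (simp add: r_distr)
    then show "k \<in> {k \<in> top_layer. e j \<otimes> k \<in> U}" using wu wu_top top_layer_mem(3) by simp
  qed
  show "{k \<in> top_layer. e j \<otimes> k \<in> U} \<subseteq> K_sub R n t e i j U"
  proof
    fix k assume k: "k \<in> {k \<in> top_layer. e j \<otimes> k \<in> U}"
    then have kc: "k \<in> carrier R" by simp
    let ?w = "\<Oplus>h\<in>{1..t} - {j}. e h \<otimes> k"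
    have "k = (\<Oplus>h\<in>{1..t}. e h \<otimes> k)"
      using finsum_ldistr[of "{1..t}" k e] kc e_sum by simp
    also have "{1..t} = insert j ({1..t} - {j})" using j by auto
    also have "(\<Oplus>h\<in>insert j ({1..t} - {j}). e h \<otimes> k) = e j \<otimes> k \<oplus> ?w"
      using j kc by (intro finsum_insert) auto
    finally have "k = ?w \<oplus> e j \<otimes> k"
      using kc j by (simp add: a_comm)
    moreover have "?w \<in> W_sub R n t e i j"
      using k unfolding W_sub_def sum_of_family_def
      by (intro CollectI exI[of _ "\<lambda>h. e h \<otimes> k"]) (auto simp: top_component_def)
    ultimately show "k \<in> K_sub R n t e i j U"
      using k by (auto simp: K_sub_def set_add_def')
  qed
qed

text \<open>
  Two representatives of a residue class differ by an element of \<open>e\<^sub>j J e\<^sub>j\<close>, which kills \<open>v\<close>; so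
  the set of products whose \<open>the_elem\<close> defines the action is the singleton \<open>{c v}\<close>.
\<close>

lemma residue_action:
  assumes r: "r \<in> carrier R" and v: "v \<in> carrier (top_corner_module R n (e j) (e i))"
  defines "c \<equiv> e j \<otimes> r \<otimes> e j"
  shows "corner R (e j) (jacobson_radical R) (e j) +>\<^bsub>corner_ring R (e j)\<^esub> c
      \<in> carrier (residue_division_ring R (e j))"
    and "(corner R (e j) (jacobson_radical R) (e j) +>\<^bsub>corner_ring R (e j)\<^esub> c)
      \<odot>\<^bsub>top_corner_module R n (e j) (e i)\<^esub> v = c \<otimes> v"
proof -
  let ?J = "corner R (e j) (jacobson_radical R) (e j)"
  interpret G: left_module R "regular_module R" by (rule left_module_regular)
  note Jm = G.submodule_mem[OF jacobson_radical_left_ideal]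
  have Jc: "y \<in> carrier R" if "y \<in> jacobson_radical R" for y
    using that by (simp add: jacobson_radical_def)
  show "?J +>\<^bsub>corner_ring R (e j)\<^esub> c \<in> carrier (residue_division_ring R (e j))"
    using r by (auto simp: residue_division_ring_def FactRing_def A_RCOSETS_def' corner_ring_def
        corner_def c_def)
  have vL: "v \<in> top_layer" using v corner_subset_top_layer by (auto simp: top_corner_module_def)
  have cc: "c \<in> carrier R" using r j by (simp add: c_def)
  have bv: "b \<otimes> v = \<zero>" "b \<in> carrier R" if b: "b \<in> ?J" for b
  proof -
    obtain y where y: "y \<in> jacobson_radical R" "b = e j \<otimes> y \<otimes> e j"
      using b by (auto simp: corner_def)
    have "b \<otimes> v = e j \<otimes> (y \<otimes> (e j \<otimes> v))" using y Jc vL j by (simp add: m_assoc)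
    also have "y \<otimes> (e j \<otimes> v) = \<zero>" by (rule radical_kills_top_layer[OF y(1)]) (use top_layer_mem(5) vL j in simp)
    finally show "b \<otimes> v = \<zero>" using j by simp
    show "b \<in> carrier R" using y Jc j by simp
  qed
  have "\<zero> \<in> jacobson_radical R" using Jm(2) by (simp add: regular_module_def)
  then have "e j \<otimes> \<zero> \<otimes> e j \<in> ?J" unfolding corner_def by blast
  then have "(\<lambda>b. (b \<oplus> c) \<otimes> v) ` ?J = {c \<otimes> v}"
    using bv cc vL by (auto simp: l_distr intro!: image_eqI)
  moreover have "(\<lambda>a. a \<otimes> v) ` (?J +>\<^bsub>corner_ring R (e j)\<^esub> c) = (\<lambda>b. (b \<oplus> c) \<otimes> v) ` ?J"
    by (auto simp: a_r_coset_def' corner_ring_def)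
  ultimately show "(?J +>\<^bsub>corner_ring R (e j)\<^esub> c) \<odot>\<^bsub>top_corner_module R n (e j) (e i)\<^esub> v = c \<otimes> v"
    by (simp add: top_corner_module_def)
qed

context
  fixes U
  assumes U: "submodule U (residue_division_ring R (e j)) (top_corner_module R n (e j) (e i))"
begin

lemma U_mem:
  shows U_subset: "U \<subseteq> top_layer" and "\<zero> \<in> U" and "\<And>x y. x \<in> U \<Longrightarrow> y \<in> U \<Longrightarrow> x \<oplus> y \<in> U"
    and "\<And>r u. r \<in> carrier R \<Longrightarrow> u \<in> U \<Longrightarrow> e j \<otimes> r \<otimes> e j \<otimes> u \<in> U"
    and U_fixed: "\<And>u. u \<in> U \<Longrightarrow> e j \<otimes> u = u"
proof -
  interpret U: submodule U "residue_division_ring R (e j)" "top_corner_module R n (e j) (e i)"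
    by (rule U)
  have sub: "U \<subseteq> carrier (top_corner_module R n (e j) (e i))" using U.subset by simp
  then show UL: "U \<subseteq> top_layer" using corner_subset_top_layer by (auto simp: top_corner_module_def)
  show "\<zero> \<in> U" using U.one_closed by (simp add: top_corner_module_def)
  show "x \<oplus> y \<in> U" if "x \<in> U" "y \<in> U" for x y
    using U.m_closed[OF that] by (simp add: top_corner_module_def)
  show "e j \<otimes> r \<otimes> e j \<otimes> u \<in> U" if "r \<in> carrier R" "u \<in> U" for r u
    using U.smult_closed[OF residue_action(1)[OF that(1)] that(2), of u] 
      residue_action(2)[OF that(1), of u] sub that(2) by auto
  interpret G: left_module R "regular_module R" by (rule left_module_regular)
  show "e j \<otimes> u = u" if u: "u \<in> U" for u
  proof -
    obtain y where y: "y \<in> ideal_power R (jacobson_radical R) (n - 1)" "u = e j \<otimes> y \<otimes> e i"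
      using u sub by (auto simp: top_corner_module_def corner_def)
    have "y \<in> carrier R"
      using G.submodule_mem(1)[OF ideal_power_left_ideal[OF jacobson_radical_left_ideal]] y
      by (auto simp: regular_module_def)
    then show ?thesis using y i j e_idem by (simp flip: m_assoc)
  qed
qed

lemma W_sub_inter: "W_sub R n t e i j \<inter> U = {\<zero>}"
proof -
  have "(\<lambda>_. \<zero>) \<in> Pi ({1..t} - {j}) (top_component R n e i)"
    using top_layer_mem(2) by (force simp: top_component_def)
  moreover have "finsum R (\<lambda>_. \<zero>) ({1..t} - {j}) = \<zero>" by simp
  ultimately have "\<zero> \<in> W_sub R n t e i j" unfolding W_sub_def sum_of_family_def by force
  then show ?thesis using W_sub_kill U_fixed U_mem(2) by force
qed

lemma K_sub_U: "K_sub R n t e i j U = {k \<in> top_layer. e j \<otimes> k \<in> U}"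
  by (intro K_sub_conv U_subset U_fixed)

lemma K_sub_submodule: "submodule (K_sub R n t e i j U) R (principal_module R (e i))"
proof -
  interpret P: left_module R "principal_module R (e i)" by (rule left_module_P)
  show ?thesis
    unfolding K_sub_U
  proof (rule P.submoduleI, unfold principal_simps)
    fix r x assume r: "r \<in> carrier R" and x: "x \<in> {k \<in> top_layer. e j \<otimes> k \<in> U}"
    then have "e j \<otimes> (r \<otimes> x) \<in> U" using diagonal_action_on_top_layer[of r x] U_mem(4) by simp
    then show "r \<otimes> x \<in> {k \<in> top_layer. e j \<otimes> k \<in> U}" using x r top_layer_mem(5) by simp
  qed (use top_layer_mem U_mem(2,3) j in \<open>auto simp: r_distr\<close>)
qed

lemma K_sub_subset: "d < n \<Longrightarrow> K_sub R n t e i j U \<subseteq> radical_submodule R (principal_module R (e i)) d"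
proof -
  assume "d < n"
  then have "top_layer \<subseteq> radical_submodule R (principal_module R (e i)) d"
    by (intro left_module.radical_submodule_antimono[OF left_module_P]) simp
  then show ?thesis unfolding K_sub_U by blast
qed

end

end

theorem proposition6p2:
  fixes K :: "('k, 'kx) ring_scheme"
    and \<Lambda> :: "('k, 'a, 'ax) module_scheme"
    and e :: "nat \<Rightarrow> 'a"
    and n t i j s :: nat
  assumes "fin_dim_algebra K \<Lambda>"
    and "n \<ge> 1"
    and "ideal_power \<Lambda> (jacobson_radical \<Lambda>) n = {\<zero>\<^bsub>\<Lambda>\<^esub>}"
    and "complete_primitive_idempotents \<Lambda> t e"
    and "basic_wrt \<Lambda> t e"
    and "i \<in> {1..t}" and "j \<in> {1..t}"
    and "carrier (top_corner_module \<Lambda> n (e j) (e i)) \<noteq> {\<zero>\<^bsub>\<Lambda>\<^esub>}"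
    and "1 \<le> s"
    and "s \<le> module_dim (residue_division_ring \<Lambda> (e j)) (top_corner_module \<Lambda> n (e j) (e i))"
  shows "(\<forall>U \<in> grassmannian_codim (residue_division_ring \<Lambda> (e j)) (top_corner_module \<Lambda> n (e j) (e i)) s.
            sum_is_direct \<Lambda> ({1..t} - {j}) (top_component \<Lambda> n e i) \<and>
            W_sub \<Lambda> n t e i j \<inter> U = {\<zero>\<^bsub>\<Lambda>\<^esub>} \<and>
            submodule (K_sub \<Lambda> n t e i j U) \<Lambda> (principal_module \<Lambda> (e i)) \<and>
            (\<forall>d. 1 \<le> d \<and> d < n \<longrightarrow>
               left_module_isomorphic \<Lambda>
                 (radical_truncation \<Lambda> (M_quot \<Lambda> n t e i j U) d)
                 (radical_truncation \<Lambda> (principal_module \<Lambda> (e i)) d))) \<and>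
         (\<forall>U \<in> grassmannian_codim (residue_division_ring \<Lambda> (e j)) (top_corner_module \<Lambda> n (e j) (e i)) s.
          \<forall>U' \<in> grassmannian_codim (residue_division_ring \<Lambda> (e j)) (top_corner_module \<Lambda> n (e j) (e i)) s.
            same_proper_truncation_tower \<Lambda> n
              (M_quot \<Lambda> n t e i j U) (M_quot \<Lambda> n t e i j U'))"
proof -
  interpret A: fin_dim_algebra K \<Lambda> by fact
  interpret D: idempotent_decomposition \<Lambda> t n e i j
    using assms A.A.ring_axioms A.basic_corner_radical[OF assms(4,5)]
    by (intro idempotent_decomposition.intro idempotent_decomposition_axioms.intro)
  interpret P: left_module \<Lambda> "principal_module \<Lambda> (e i)" by (rule D.left_module_P)
  have sub: "submodule U (residue_division_ring \<Lambda> (e j)) (top_corner_module \<Lambda> n (e j) (e i))"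
    if "U \<in> grassmannian_codim (residue_division_ring \<Lambda> (e j)) (top_corner_module \<Lambda> n (e j) (e i)) s"
    for U using that by (simp add: grassmannian_codim_def)
  have "left_module_isomorphic \<Lambda> (radical_truncation \<Lambda> (M_quot \<Lambda> n t e i j U) d)
      (radical_truncation \<Lambda> (principal_module \<Lambda> (e i)) d)"
    if "d < n" and "submodule U (residue_division_ring \<Lambda> (e j)) (top_corner_module \<Lambda> n (e j) (e i))"
    for d U
    using P.radical_truncation_quotient(1)[OF D.K_sub_submodule[OF that(2)] D.K_sub_subset[OF that(2,1)]]
    by (auto simp: left_module_isomorphic_def M_quot_def)
  moreover have "same_proper_truncation_tower \<Lambda> n (M_quot \<Lambda> n t e i j U) (M_quot \<Lambda> n t e i j U')"
    if "submodule U (residue_division_ring \<Lambda> (e j)) (top_corner_module \<Lambda> n (e j) (e i))"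
      "submodule U' (residue_division_ring \<Lambda> (e j)) (top_corner_module \<Lambda> n (e j) (e i))" for U U'
    unfolding M_quot_def
    by (intro P.same_truncation_tower_quotients D.K_sub_submodule D.K_sub_subset that)
  ultimately show ?thesis
    using D.top_components_direct D.W_sub_inter D.K_sub_submodule sub by simp
qed

end
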